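(* Let $\boldsymbol n=(n_1,n_2,n_3)\in\mathbb Z^3_{\ge 1}$, let $f,f'\in\mathcal V_{\boldsymbol n}$, and let $\triangle,\triangle'\in T$ be two triangles such that $\overline\triangle\cap\overline{\triangle'}\in E_i$ for some $i\in\{1,2,3\}$. Let $M=\hat\triangle\cup\hat\triangle'$ and $\boldsymbol d=(n_2+n_3-2,\;n_1+n_3-2,\;n_1+n_2-2)$. Then the following two statements are equivalent: (i) The pair $(f|_\triangle,f'|_{\triangle'})$ belongs to $\mathbb S^{\boldsymbol d}(M,\mathcal V_{\boldsymbol n})$. (ii) For every $\beta\in B_{\boldsymbol n}(\hat\triangle)\cap B_{\boldsymbol n}(\hat\triangle')$ one has $\lambda^\beta_\triangle(f|_\triangle)=\lambda^\beta_{\triangle'}(f'|_{\triangle'})$.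
   Context: Grid. $G$ is the uniform type-I (three-directional) triangulation of $\mathbb R^2$ with vertex set $\mathbb Z^2$, obtained from the lines $x=k$, $y=k$, $x-y=k$ ($k\in\mathbb Z$). The directions are $\boldsymbol e_1=(1,0)$, $\boldsymbol e_2=(0,1)$, $\boldsymbol e_3=(1,1)$. $T$ is the set of triangles of $G$, regarded as open sets; $E_i$ is the set of edges (closed segments between adjacent vertices) parallel to $\boldsymbol e_i$. For $\triangle\in T$, $\hat\triangle$ is the set consisting of $\triangle$, its three edges and its three vertices, and $\overline\triangle$ is the topological closure. A multicell domain is a finite union $M=\bigcup_i\hat\triangle_i$ with $\triangle_i\in T$; $M^*=\bigcup_{\triangle\in M}\overline\triangle$. Box splines. For a function $\beta$, $\mathrm{supp}(\beta)=\{\boldsymbol x:\beta(\boldsymbol x)\ne0\}$. $\mathcal B_{(1,1,1)}$ is the Courant hat function: the continuous function on $\mathbb R^2$, affine on each triangle of $G$, with value $1$ at $(1,1)$ and $0$ at every other point of $\mathbb Z^2$. For $\boldsymbol n\in\mathbb Z_{\ge1}^3$ the type-I box spline $\mathcal B_{\boldsymbol n}$ is defined recursively by $\mathcal B_{\boldsymbol n}(\boldsymbol x)=\int_0^1\mathcal B_{\boldsymbol n'}(\boldsymbol x-t\boldsymbol e_i)\,dt$, where $\boldsymbol n'$ is $\boldsymbol n$ with $n_i$ replaced by $n_i-1$, for any $i$ with $n_i\ge2$ (the result does not depend on the order of the choices of $i$). $\mathcal B_{\boldsymbol n}$ is piecewise polynomial on $G$ of total degree at most $n_1+n_2+n_3-2$.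 Active translates. For $\triangle\in T$, $B_{\boldsymbol n}(\hat\triangle)$ is the set of translates $\mathcal B_{\boldsymbol n}(\cdot-\boldsymbol v)$, $\boldsymbol v\in\mathbb Z^2$, whose support meets $\overline\triangle$ (equivalently contains $\triangle$). An element of $B_{\boldsymbol n}(\hat\triangle)\cap B_{\boldsymbol n}(\hat\triangle')$ is a translate active on both triangles (translates being identified by $\boldsymbol v$). The restrictions to $\triangle$ of the elements of $B_{\boldsymbol n}(\hat\triangle)$ are linearly independent, and the space of polynomials in $\mathbb R[x,y]$ whose restrictions to $\triangle$ form the span of these restrictions does not depend on $\triangle\in T$; this polynomial space is denoted $\mathcal V_{\boldsymbol n}$. For $f\in\mathcal V_{\boldsymbol n}$ and $\triangle\in T$, the real numbers $\lambda^\beta_\triangle(f|_\triangle)$ are the unique coefficients with $f|_\triangle=\sum_{\beta\in B_{\boldsymbol n}(\hat\triangle)}\lambda^\beta_\triangle(f|_\triangle)\,\beta$ on $\overline\triangle$. Spline space. For a multicell domain $M$, a linear space $\mathcal V\subseteq\mathbb R[x,y]$ and $\boldsymbol d=(d_1,d_2,d_3)\in\mathbb Z_{\ge0}^3$, $\mathbb P(M,\mathcal V)$ is the set of $f\in C^0(M^* )$ such that $f|_\triangle$ is the restriction of an element of $\mathcal V$ for each triangle $\triangle\in M$. $\mathbb S^{\boldsymbol d}(M,\mathcal V)$ is the set of $f\in\mathbb P(M,\mathcal V)$ such that for every $i\in\{1,2,3\}$ and every edge $\varepsilon\in E_i\cap M$, $f$ is $C^{d_i}$ on the union of the closures of the (at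 most two) triangles of $M$ having $\varepsilon$ as an edge; i.e. if there are two such triangles, all partial derivatives of order $\le d_i$ of the two polynomial pieces agree on $\varepsilon$. The pair $(f|_\triangle,f'|_{\triangle'})$ denotes the piecewise polynomial equal to $f$ on $\triangle$ and to $f'$ on $\triangle'$; saying that it lies in a space of continuous functions includes that the two pieces agree on the common edge. *)

theory Defs
  imports "HOL-Analysis.Analysis"
begin

section \<open>The type-I triangulation\<close>

type_synonym point = "real \<times> real"

text \<open>
  The index type \<open>3\<close> has the elements \<open>1\<close>, \<open>2\<close> and \<open>3 = 0\<close>, so \<open>nat ^ 3\<close> is the type of
  triples of natural numbers with components \<open>n $ 1\<close>, \<open>n $ 2\<close>, \<open>n $ 3\<close>.
\<close>

definition dir :: "3 \<Rightarrow> point" where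
  "dir i = (if i = 1 then (1, 0) else if i = 2 then (0, 1) else (1, 1))"

abbreviation lattice :: "point set" where
  "lattice \<equiv> \<int> \<times> \<int>"

text \<open>
  The lines \<open>x = k\<close>, \<open>y = k\<close>, \<open>x - y = k\<close> cut each unit square with lower left corner \<open>v\<close> along
  its diagonal; \<open>triangle 1 v\<close> and \<open>triangle 2 v\<close> are the open halves below and above the diagonal.
\<close>

definition triangle :: "3 \<Rightarrow> point \<Rightarrow> point set" where
  "triangle i v = interior (convex hull {v, v + dir i, v + dir 3})"

definition triangles :: "point set set" where
  "triangles = {triangle i v | i v. i \<in> {1, 2} \<and> v \<in> lattice}"

definition edges :: "3 \<Rightarrow> point set set" where
  "edges i = {closed_segment v (v + dir i) | v. v \<in> lattice}"

text \<open>
  A cell (triangle, edge or vertex) is a set of points, with a vertex \<open>v\<close> represented by \<open>{v}\<close>;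
  a multicell domain is a set of cells.
\<close>

definition cell_hat :: "point set \<Rightarrow> point set set" where
  "cell_hat t = {t} \<union> {\<epsilon> \<in> (\<Union>i. edges i). \<epsilon> \<subseteq> closure t} \<union> {{v} | v. v \<in> lattice \<inter> closure t}"

definition body :: "point set set \<Rightarrow> point set" where
  "body M = (\<Union>t \<in> triangles \<inter> M. closure t)"


section \<open>Box splines\<close>

definition is_courant_hat :: "(point \<Rightarrow> real) \<Rightarrow> bool" where
  "is_courant_hat f \<longleftrightarrow>
     continuous_on UNIV f \<and>
     (\<forall>t \<in> triangles. \<exists>a b c. \<forall>x y. (x, y) \<in> t \<longrightarrow> f (x, y) = a * x + b * y + c) \<and>
     f (1, 1) = 1 \<and> (\<forall>v \<in> lattice - {(1, 1)}. f v = 0)"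

definition courant_hat :: "point \<Rightarrow> real" where
  "courant_hat = (THE f. is_courant_hat f)"

definition dir_avg :: "3 \<Rightarrow> (point \<Rightarrow> real) \<Rightarrow> point \<Rightarrow> real" where
  "dir_avg i f x = integral {0..1} (\<lambda>t. f (x - t *\<^sub>R dir i))"

text \<open>
  One admissible order of the recursion is fixed here; \<open>box_spline_rec\<close> below shows that
  the recursion holds for every direction \<open>i\<close> with \<open>n $ i \<ge> 2\<close>. Only \<open>n\<close> with all
  components at least \<open>1\<close> is meaningful.
\<close>

definition box_spline :: "nat ^ 3 \<Rightarrow> point \<Rightarrow> real" where
  "box_spline n =
     (dir_avg 1 ^^ (n $ 1 - 1)) ((dir_avg 2 ^^ (n $ 2 - 1)) ((dir_avg 3 ^^ (n $ 3 - 1)) courant_hat))"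


section \<open>Active translates and the local polynomial space\<close>

text \<open>
  The translate \<open>\<lambda>x. box_spline n (x - v)\<close> is identified by \<open>v\<close>. The support is the set where the
  function does not vanish, without taking the closure.
\<close>

definition active :: "nat ^ 3 \<Rightarrow> point set \<Rightarrow> point set" where
  "active n t = {v \<in> lattice. {x. box_spline n (x - v) \<noteq> 0} \<inter> closure t \<noteq> {}}"

text \<open>
  Real polynomials in two variables are represented by their polynomial functions.
  Since the space of polynomials whose restrictions to a triangle \<open>t\<close> lie in the span of the
  active translates does not depend on \<open>t\<close>, no triangle is singled out.
\<close>

definition poly_space :: "nat ^ 3 \<Rightarrow> (point \<Rightarrow> real) set" where
  "poly_space n = {p. real_polynomial_function p \<and>
     (\<forall>t \<in> triangles. \<exists>c. \<forall>x \<in> t. p x = (\<Sum>v \<in> active n t. c v * box_spline n (x - v)))}"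

definition spline_coeff :: "nat ^ 3 \<Rightarrow> point set \<Rightarrow> (point \<Rightarrow> real) \<Rightarrow> point \<Rightarrow> real" where
  "spline_coeff n t f = (THE c. (\<forall>v. v \<notin> active n t \<longrightarrow> c v = 0) \<and>
     (\<forall>x \<in> closure t. f x = (\<Sum>v \<in> active n t. c v * box_spline n (x - v))))"


section \<open>Spline spaces with directional smoothness\<close>

definition partial_deriv :: "3 \<Rightarrow> (point \<Rightarrow> real) \<Rightarrow> point \<Rightarrow> real" where
  "partial_deriv i f x = deriv (\<lambda>s. f (x + s *\<^sub>R dir i)) 0"

text \<open>
  Functions on \<open>body M\<close> are represented by total functions whose values elsewhere are irrelevant.
\<close>

definition pp_space :: "point set set \<Rightarrow> (point \<Rightarrow> real) set \<Rightarrow> (point \<Rightarrow> real) set" where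
  "pp_space M V = {f. continuous_on (body M) f \<and>
     (\<forall>t \<in> triangles \<inter> M. \<exists>p \<in> V. \<forall>x \<in> t. f x = p x)}"

text \<open>
  In the smoothness condition \<open>p\<close> and \<open>q\<close> are the polynomial pieces of \<open>f\<close> on \<open>t\<close> and \<open>t'\<close>;
  they are determined by \<open>f\<close>. The condition is trivial for \<open>t = t'\<close>.
\<close>

definition spline_space ::
  "nat ^ 3 \<Rightarrow> point set set \<Rightarrow> (point \<Rightarrow> real) set \<Rightarrow> (point \<Rightarrow> real) set" where
  "spline_space d M V = {f \<in> pp_space M V.
     \<forall>i. \<forall>\<epsilon> \<in> edges i \<inter> M. \<forall>t \<in> triangles \<inter> M. \<forall>t' \<in> triangles \<inter> M.
       \<epsilon> \<in> cell_hat t \<longrightarrow> \<epsilon> \<in> cell_hat t' \<longrightarrow>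
       (\<forall>p \<in> V. \<forall>q \<in> V. (\<forall>x \<in> t. f x = p x) \<longrightarrow> (\<forall>x \<in> t'. f x = q x) \<longrightarrow>
         (\<forall>a b. a + b \<le> d $ i \<longrightarrow> (\<forall>x \<in> \<epsilon>.
            (partial_deriv 1 ^^ a) ((partial_deriv 2 ^^ b) p) x =
            (partial_deriv 1 ^^ a) ((partial_deriv 2 ^^ b) q) x)))}"

text \<open>
  The pair of pieces \<open>f\<close> on \<open>t\<close> and \<open>f'\<close> on an adjacent triangle. The choice of \<open>f\<close> on the common
  edge is immaterial: \<open>glue t f f'\<close> is continuous on the union of the two closed triangles only
  if \<open>f\<close> and \<open>f'\<close> agree on that edge.
\<close>

definition glue :: "point set \<Rightarrow> (point \<Rightarrow> real) \<Rightarrow> (point \<Rightarrow> real) \<Rightarrow> point \<Rightarrow> real" where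
  "glue t f f' x = (if x \<in> closure t then f x else f' x)"


section \<open>The definitions describe the intended objects\<close>

lemma dir_simps [simp]: "dir 1 = (1, 0)" "dir 2 = (0, 1)" "dir 3 = (1, 1)"
  by (auto simp: dir_def)

lemma closed_triangle_1:
  "convex hull {(a, b), (a, b) + dir 1, (a, b) + dir 3} =
     {(x, y). b \<le> y \<and> y - b \<le> x - a \<and> x - a \<le> 1}"
proof -
  have "\<exists>u v. p = (a, b) + u *\<^sub>R ((a, b) + dir 1 - (a, b)) + v *\<^sub>R ((a, b) + dir 3 - (a, b)) \<and>
      0 \<le> u \<and> 0 \<le> v \<and> u + v \<le> 1"
    if "p \<in> {(x, y). b \<le> y \<and> y - b \<le> x - a \<and> x - a \<le> 1}" for p
    using that
    by (intro exI[of _ "fst p - a - (snd p - b)"] exI[of _ "snd p - b"]) (auto simp: prod_eq_iff)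
  then show ?thesis
    unfolding convex_hull_3_alt by (auto simp: algebra_simps)
qed

lemma closed_triangle_2:
  "convex hull {(a, b), (a, b) + dir 2, (a, b) + dir 3} =
     {(x, y). a \<le> x \<and> x - a \<le> y - b \<and> y - b \<le> 1}"
proof -
  have "\<exists>u v. p = (a, b) + u *\<^sub>R ((a, b) + dir 2 - (a, b)) + v *\<^sub>R ((a, b) + dir 3 - (a, b)) \<and>
      0 \<le> u \<and> 0 \<le> v \<and> u + v \<le> 1"
    if "p \<in> {(x, y). a \<le> x \<and> x - a \<le> y - b \<and> y - b \<le> 1}" for p
    using that
    by (intro exI[of _ "snd p - b - (fst p - a)"] exI[of _ "fst p - a"]) (auto simp: prod_eq_iff)
  then show ?thesis
    unfolding convex_hull_3_alt by (auto simp: algebra_simps)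
qed

lemma triangle_1: "triangle 1 (a, b) = {(x, y). b < y \<and> y - b < x - a \<and> x - a < 1}"
proof -
  have "{(x, y). b \<le> y \<and> y - b \<le> x - a \<and> x - a \<le> 1} =
      {p. (0, 1) \<bullet> p \<ge> b} \<inter> {p. (1, -1) \<bullet> p \<ge> a - b} \<inter> {p. (1, 0) \<bullet> p \<le> a + (1::real)}"
    by auto
  moreover have "{(x, y). b < y \<and> y - b < x - a \<and> x - a < 1} =
      {p. (0, 1) \<bullet> p > b} \<inter> {p. (1, -1) \<bullet> p > a - b} \<inter> {p. (1, 0) \<bullet> p < a + (1::real)}"
    by auto
  ultimately show ?thesis
    unfolding triangle_def closed_triangle_1
    by (simp only: interior_Int)
      (simp add: interior_halfspace_le interior_halfspace_ge zero_prod_def)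
qed

lemma triangle_2: "triangle 2 (a, b) = {(x, y). a < x \<and> x - a < y - b \<and> y - b < 1}"
proof -
  have "{(x, y). a \<le> x \<and> x - a \<le> y - b \<and> y - b \<le> 1} =
      {p. (1, 0) \<bullet> p \<ge> a} \<inter> {p. (1, -1) \<bullet> p \<le> a - b} \<inter> {p. (0, 1) \<bullet> p \<le> b + (1::real)}"
    by auto
  moreover have "{(x, y). a < x \<and> x - a < y - b \<and> y - b < 1} =
      {p. (1, 0) \<bullet> p > a} \<inter> {p. (1, -1) \<bullet> p < a - b} \<inter> {p. (0, 1) \<bullet> p < b + (1::real)}"
    by auto
  ultimately show ?thesis
    unfolding triangle_def closed_triangle_2
    by (simp only: interior_Int)
      (simp add: interior_halfspace_le interior_halfspace_ge zero_prod_def)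
qed

lemma triangle_nonempty: "i \<in> {1, 2} \<Longrightarrow> triangle i v \<noteq> {}"
proof (cases v)
  case (Pair a b)
  assume "i \<in> {1, 2}"
  then consider "i = 1" | "i = 2" by blast
  then show ?thesis
  proof cases
    case 1
    have "(a + 2/3, b + 1/3) \<in> triangle i v" by (simp add: 1 Pair triangle_1)
    then show ?thesis by blast
  next
    case 2
    have "(a + 1/3, b + 2/3) \<in> triangle i v" by (simp add: 2 Pair triangle_2)
    then show ?thesis by blast
  qed
qed

lemma closure_triangle:
  assumes "i \<in> {1, 2}"
  shows "closure (triangle i v) = convex hull {v, v + dir i, v + dir 3}"
proof -
  have "closure (triangle i v) = closure (convex hull {v, v + dir i, v + dir 3})"
    using triangle_nonempty[OF assms, of v] unfolding triangle_def
    by (intro convex_closure_interior) auto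
  also have "\<dots> = convex hull {v, v + dir i, v + dir 3}"
    by (intro closure_closed compact_imp_closed finite_imp_compact_convex_hull) auto
  finally show ?thesis .
qed

lemma triangles_cover: "\<exists>t \<in> triangles. p \<in> closure t"
proof (cases p)
  case (Pair x y)
  define v :: point where "v = (of_int \<lfloor>x\<rfloor>, of_int \<lfloor>y\<rfloor>)"
  have v: "v \<in> lattice" by (auto simp: v_def)
  define i :: 3 where "i = (if y - of_int \<lfloor>y\<rfloor> \<le> x - of_int \<lfloor>x\<rfloor> then 1 else 2)"
  have i: "i \<in> {1, 2}" by (simp add: i_def)
  have "x - of_int \<lfloor>x\<rfloor> \<le> 1" "y - of_int \<lfloor>y\<rfloor> \<le> 1" by linarith+
  then have "p \<in> convex hull {v, v + dir i, v + dir 3}"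
    by (cases "y - of_int \<lfloor>y\<rfloor> \<le> x - of_int \<lfloor>x\<rfloor>")
      (simp_all only: v_def i_def Pair if_True if_False closed_triangle_1 closed_triangle_2, auto)
  then show ?thesis
    using v i closure_triangle[OF i, of v] unfolding triangles_def by blast
qed

lemma is_courant_hat_unique:
  assumes "is_courant_hat f" "is_courant_hat g"
  shows "f = g"
proof
  fix p
  obtain t where t: "t \<in> triangles" "p \<in> closure t" using triangles_cover by blast
  then obtain i v where iv: "i \<in> {1, 2}" "v \<in> lattice" "t = triangle i v"
    unfolding triangles_def by blast
  define h where "h q = f q - g q" for q
  have cont: "continuous_on UNIV h"
    using assms unfolding is_courant_hat_def h_def by (intro continuous_on_diff) auto
  obtain a b c a' b' c' where
    f: "\<And>x y. (x, y) \<in> t \<Longrightarrow> f (x, y) = a * x + b * y + c" and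
    g: "\<And>x y. (x, y) \<in> t \<Longrightarrow> g (x, y) = a' * x + b' * y + c'"
    using assms t(1) unfolding is_courant_hat_def by metis
  define A B C where "A = a - a'" and "B = b - b'" and "C = c - c'"
  have cl: "h q = A * fst q + B * snd q + C" if "q \<in> closure t" for q
  proof -
    have "h q - (A * fst q + B * snd q + C) = 0"
    proof (rule continuous_constant_on_closure[OF _ _ that])
      show "continuous_on (closure t) (\<lambda>q. h q - (A * fst q + B * snd q + C))"
        by (intro continuous_intros continuous_on_subset[OF cont]) auto
      show "h q - (A * fst q + B * snd q + C) = 0" if "q \<in> t" for q
        using that f[of "fst q" "snd q"] g[of "fst q" "snd q"]
        by (simp add: h_def A_def B_def C_def algebra_simps)
    qed
    then show ?thesis by simp
  qed
  have lat: "h q = 0" if "q \<in> lattice" for q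
    using assms that unfolding is_courant_hat_def h_def by (cases "q = (1, 1)") auto
  have vert: "q \<in> closure t" if "q \<in> {v, v + dir i, v + dir 3}" for q
    using that iv closure_triangle[OF iv(1), of v] hull_inc[OF that] by simp
  have "A * fst q + B * snd q + C = 0" if "q \<in> {v, v + dir i, v + dir 3}" for q
  proof -
    have "q \<in> lattice" using that iv(1,2) by auto
    then show ?thesis using cl[OF vert[OF that]] lat[of q] by simp
  qed
  from this[of v] this[of "v + dir i"] this[of "v + dir 3"] have "A = 0 \<and> B = 0 \<and> C = 0"
    using iv(1) by (auto simp: algebra_simps)
  then show "f p = g p" using cl[OF t(2)] by (simp add: h_def)
qed

lemma is_courant_hat_explicit:
  "is_courant_hat (\<lambda>(x, y). max 0 (1 - max (max \<bar>x - 1\<bar> \<bar>y - 1\<bar>) \<bar>x - y\<bar>))"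
    (is "is_courant_hat ?f")
  unfolding is_courant_hat_def
proof (intro conjI ballI)
  show "continuous_on UNIV ?f"
    unfolding case_prod_beta by (intro continuous_intros)
  show "?f (1, 1) = 1" by simp
  show "?f v = 0" if "v \<in> lattice - {(1, 1)}" for v
  proof -
    from that obtain k l :: int where v: "v = (of_int k, of_int l)" and "k \<noteq> 1 \<or> l \<noteq> 1"
      by (auto elim!: Ints_cases)
    then have "1 \<le> max \<bar>k - 1\<bar> \<bar>l - 1\<bar>" by auto
    then have "1 \<le> max \<bar>real_of_int k - 1\<bar> \<bar>real_of_int l - 1\<bar>" by linarith
    then show ?thesis by (simp add: v max_def)
  qed
  show "\<exists>a b c. \<forall>x y. (x, y) \<in> t \<longrightarrow> ?f (x, y) = a * x + b * y + c" if t: "t \<in> triangles" for t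
  proof -
    from t obtain i k l where i: "i \<in> {1, 2}" and t: "t = triangle i (of_int k, of_int l)"
      unfolding triangles_def by (auto elim!: Ints_cases)
    have k: "k \<le> -1 \<or> k = 0 \<or> k = 1 \<or> k \<ge> 2" and l: "l \<le> -1 \<or> l = 0 \<or> l = 1 \<or> l \<ge> 2" by auto
    consider "i = 1" | "i = 2" using i by blast
    then show ?thesis
    proof cases
      case 1
      consider "k = 0 \<and> l = 0" | "k = 0 \<and> l = 1" | "k = 1 \<and> l = 1" | "k = 1 \<and> l = 0"
        | "k \<le> -1 \<or> k \<ge> 2 \<or> l \<le> -1 \<or> l \<ge> 2" by linarith
      then show ?thesis
      proof cases
        case A: 1
        show ?thesis
          by (rule exI[of _ 0], rule exI[of _ 1], rule exI[of _ 0])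
            (use A in \<open>auto simp: t 1 triangle_1\<close>)
      next
        case A: 2
        show ?thesis
          by (rule exI[of _ 1], rule exI[of _ "-1"], rule exI[of _ 1])
            (use A in \<open>auto simp: t 1 triangle_1\<close>)
      next
        case A: 3
        show ?thesis
          by (rule exI[of _ "-1"], rule exI[of _ 0], rule exI[of _ 2])
            (use A in \<open>auto simp: t 1 triangle_1\<close>)
      next
        case A: 4
        show ?thesis
          by (rule exI[of _ 0], rule exI[of _ 0], rule exI[of _ 0])
            (use A in \<open>auto simp: t 1 triangle_1\<close>)
      next
        case A: 5
        then have "real_of_int k \<le> -1 \<or> real_of_int k \<ge> 2 \<or> real_of_int l \<le> -1 \<or> real_of_int l \<ge> 2"
          by linarith
        then show ?thesis
          by (intro exI[of _ 0]) (auto simp: t 1 triangle_1)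
      qed
    next
      case 2
      consider "k = 0 \<and> l = 0" | "k = 1 \<and> l = 0" | "k = 1 \<and> l = 1" | "k = 0 \<and> l = 1"
        | "k \<le> -1 \<or> k \<ge> 2 \<or> l \<le> -1 \<or> l \<ge> 2" by linarith
      then show ?thesis
      proof cases
        case A: 1
        show ?thesis
          by (rule exI[of _ 1], rule exI[of _ 0], rule exI[of _ 0])
            (use A in \<open>auto simp: t 2 triangle_2\<close>)
      next
        case A: 2
        show ?thesis
          by (rule exI[of _ "-1"], rule exI[of _ 1], rule exI[of _ 1])
            (use A in \<open>auto simp: t 2 triangle_2\<close>)
      next
        case A: 3
        show ?thesis
          by (rule exI[of _ 0], rule exI[of _ "-1"], rule exI[of _ 2])
            (use A in \<open>auto simp: t 2 triangle_2\<close>)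
      next
        case A: 4
        show ?thesis
          by (rule exI[of _ 0], rule exI[of _ 0], rule exI[of _ 0])
            (use A in \<open>auto simp: t 2 triangle_2\<close>)
      next
        case A: 5
        then have "real_of_int k \<le> -1 \<or> real_of_int k \<ge> 2 \<or> real_of_int l \<le> -1 \<or> real_of_int l \<ge> 2"
          by linarith
        then show ?thesis
          by (intro exI[of _ 0]) (auto simp: t 2 triangle_2)
      qed
    qed
  qed
qed

lemma is_courant_hat_courant_hat: "is_courant_hat courant_hat"
  unfolding courant_hat_def
  by (rule theI[where P = is_courant_hat, OF is_courant_hat_explicit])
    (rule is_courant_hat_unique[OF _ is_courant_hat_explicit])

lemma courant_hat_explicit:
  "courant_hat (x, y) = max 0 (1 - max (max \<bar>x - 1\<bar> \<bar>y - 1\<bar>) \<bar>x - y\<bar>)"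
  by (subst is_courant_hat_unique[OF is_courant_hat_courant_hat is_courant_hat_explicit]) simp

lemma continuous_on_courant_hat: "continuous_on UNIV courant_hat"
  using is_courant_hat_courant_hat unfolding is_courant_hat_def by blast

lemma continuous_on_dir_avg:
  assumes "continuous_on UNIV f"
  shows "continuous_on UNIV (dir_avg i f)"
proof -
  have "continuous_on UNIV (\<lambda>x. integral (cbox 0 1) (\<lambda>t::real. f (x - t *\<^sub>R dir i)))"
    by (rule integral_continuous_on_param, unfold case_prod_beta)
      (intro continuous_on_compose2[OF assms] continuous_intros, auto)
  then show ?thesis by (simp add: dir_avg_def[abs_def])
qed

lemma dir_avg_commute:
  assumes "continuous_on UNIV f"
  shows "dir_avg i (dir_avg j f) = dir_avg j (dir_avg i f)"
proof
  fix x
  have "integral (cbox 0 1) (\<lambda>s::real. integral (cbox 0 1) (\<lambda>t::real. f (x - s *\<^sub>R dir i - t *\<^sub>R dir j))) =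
      integral (cbox 0 1) (\<lambda>t. integral (cbox 0 1) (\<lambda>s. f (x - s *\<^sub>R dir i - t *\<^sub>R dir j)))"
    by (rule integral_swap_continuous, unfold case_prod_beta)
      (intro continuous_on_compose2[OF assms] continuous_intros, auto)
  then show "dir_avg i (dir_avg j f) x = dir_avg j (dir_avg i f) x"
    by (simp add: dir_avg_def algebra_simps)
qed

lemma continuous_on_dir_avg_funpow:
  "continuous_on UNIV f \<Longrightarrow> continuous_on UNIV ((dir_avg i ^^ k) f)"
  by (induction k) (auto intro: continuous_on_dir_avg)

lemma dir_avg_funpow_commute:
  assumes "continuous_on UNIV f"
  shows "dir_avg i ((dir_avg j ^^ k) f) = (dir_avg j ^^ k) (dir_avg i f)"
proof (induction k)
  case (Suc k)
  have "dir_avg i (dir_avg j ((dir_avg j ^^ k) f)) = dir_avg j (dir_avg i ((dir_avg j ^^ k) f))"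
    by (rule dir_avg_commute[OF continuous_on_dir_avg_funpow[OF assms]])
  then show ?case by (simp add: Suc)
qed simp

lemma box_spline_one: "box_spline (\<chi> i. 1) = courant_hat"
  by (simp add: box_spline_def)

lemma box_spline_rec:
  assumes "n $ i \<ge> 2"
  shows "box_spline n x =
    integral {0..1} (\<lambda>t. box_spline (\<chi> j. if j = i then n $ j - 1 else n $ j) (x - t *\<^sub>R dir i))"
proof -
  let ?n' = "(\<chi> j. if j = i then n $ j - 1 else n $ j) :: nat ^ 3"
  obtain m where m: "n $ i = Suc (Suc m)"
    using assms by (metis add_2_eq_Suc le_Suc_ex)
  have "box_spline n = dir_avg i (box_spline ?n')"
    using m exhaust_3[of i] unfolding box_spline_def
    by (auto simp: dir_avg_funpow_commute continuous_on_dir_avg_funpow continuous_on_courant_hat)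
  then show ?thesis by (simp add: dir_avg_def)
qed

end

theory Submission
  imports Defs
begin

text \<open>
  Write \<open>m = n - (1, 1, 1)\<close>. The derivative along \<open>dir j\<close> of a spline \<open>\<Sum>v. c v * B\<^sub>m(\<cdot> - v)\<close> with \<open>m j > 0\<close>
  is the spline of order \<open>m - e\<^sub>j\<close> whose coefficients are the differences of \<open>c\<close> in direction \<open>j\<close>.

  If the common coefficients agree, then \<open>f\<close> and \<open>f'\<close> are pieces of one spline. Differentiating along the two
  directions transversal to the edge \<open>E\<close> lowers the order down to a continuous spline, and derivatives
  along \<open>E\<close> preserve vanishing on \<open>E\<close>; hence \<open>f - f'\<close> vanishes on \<open>E\<close> to the order \<open>\<Sum>j\<noteq>i. m j\<close>.

  Conversely, if \<open>f - f'\<close> vanishes to that order, then the spline whose coefficients \<open>c\<close> are the differences of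
  those of \<open>f\<close> and \<open>f'\<close> vanishes on \<open>E\<close> together with all its formal derivatives. By induction on \<open>m\<close>, the
  differences of \<open>c\<close> in direction \<open>j\<close> vanish on the translates of order \<open>m - e\<^sub>j\<close> that are active on \<open>E\<close>, so among
  the translates of order \<open>m\<close> active on \<open>E\<close> the coefficient is constant along \<open>dir j\<close>. But for coefficients
  invariant along \<open>dir j\<close> the splines of orders \<open>m\<close> and \<open>m - e\<^sub>j\<close> coincide, and the induction hypothesis
  applies once more to give \<open>c = 0\<close>. With \<open>f = f' = 0\<close> the same argument yields local linear independence.
\<close>

section \<open>Box splines indexed by their excess over (1, 1, 1)\<close>

abbreviation bump :: "3 \<Rightarrow> (3 \<Rightarrow> nat) \<Rightarrow> 3 \<Rightarrow> nat" where
  "bump j m \<equiv> m(j := Suc (m j))"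

lemma bump_commute: "bump j (bump k m) = bump k (bump j m)"
  by (auto simp: fun_eq_iff)

text \<open>Induction on the sum of the components: unless \<open>m\<close> is zero, some component
  can be lowered by one. The direction of the step stays arbitrary, so all three are treated at
  once.\<close>

lemma bump_induct [case_names zero bump]:
  assumes "P (\<lambda>_. 0)" and "\<And>j m. P m \<Longrightarrow> P (bump j m)"
  shows "P m"
proof (induction "\<Sum>k\<in>UNIV. m k" arbitrary: m)
  case 0
  then have "m = (\<lambda>_. 0)" by (auto simp: fun_eq_iff)
  then show ?case using assms(1) by simp
next
  case (Suc s)
  then obtain j where j: "m j \<noteq> 0" by fastforce
  define m' where "m' = m(j := m j - 1)"
  have m: "m = bump j m'" using j by (auto simp: m'_def)
  have "(\<Sum>k\<in>UNIV. m k) = Suc (\<Sum>k\<in>UNIV. m' k)"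
    unfolding m by (subst (1 2) sum.remove[of UNIV j]) auto
  then show ?case using Suc assms(2) m by (metis Suc_inject)
qed

text \<open>\<open>m j\<close> counts the averagings along \<open>dir j\<close>, which avoids
  truncated subtraction; plain functions admit the update written as \<open>bump\<close>.\<close>

definition bs :: "(3 \<Rightarrow> nat) \<Rightarrow> point \<Rightarrow> real" where
  "bs m = (dir_avg 1 ^^ m 1) ((dir_avg 2 ^^ m 2) ((dir_avg 3 ^^ m 3) courant_hat))"

lemma box_spline_eq_bs: "box_spline n = bs (\<lambda>j. n $ j - 1)"
  by (simp add: box_spline_def bs_def)

lemma bs_zero: "bs (\<lambda>_. 0) = courant_hat"
  by (simp add: bs_def)

text \<open>Averagings commute on continuous functions, so the additional one can be moved to the
  front.\<close>

lemma bs_bump: "bs (bump j m) = dir_avg j (bs m)"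
  using exhaust_3[of j] unfolding bs_def
  by (auto simp: dir_avg_funpow_commute continuous_on_dir_avg_funpow continuous_on_courant_hat)

lemma continuous_on_bs: "continuous_on A (bs m)"
  by (rule continuous_on_subset[of UNIV], unfold bs_def)
    (intro continuous_on_dir_avg_funpow continuous_on_courant_hat, simp)

text \<open>An open zonotope: the interior of the Minkowski sum of the segments from 0 to
  \<open>m j + 1\<close> times \<open>dir j\<close>.\<close>

definition hexagon :: "(3 \<Rightarrow> nat) \<Rightarrow> point set" where
  "hexagon m = {(x, y). 0 < x \<and> x < real (m 1 + m 3 + 2) \<and> 0 < y \<and> y < real (m 2 + m 3 + 2) \<and>
     - real (m 2 + 1) < x - y \<and> x - y < real (m 1 + 1)}"

lemma dir_avg_eq_0_iff:
  assumes "continuous_on UNIV f" and "\<And>x. 0 \<le> f x"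
  shows "dir_avg j f x = 0 \<longleftrightarrow> (\<forall>s\<in>{0..1}. f (x - s *\<^sub>R dir j) = 0)"
  unfolding dir_avg_def using assms(2)
  by (intro integral_eq_0_iff continuous_on_compose2[OF assms(1)] continuous_intros) auto

lemma dir_avg_nonneg:
  assumes "continuous_on UNIV f" and "\<And>x. 0 \<le> f x"
  shows "0 \<le> dir_avg j f x"
  unfolding dir_avg_def using assms(2)
  by (intro integral_nonneg integrable_continuous_real continuous_on_compose2[OF assms(1)]
      continuous_intros) auto

lemma bs_nonneg: "0 \<le> bs m x"
proof (induction m arbitrary: x rule: bump_induct)
  case zero
  then show ?case by (cases x) (simp add: bs_zero courant_hat_explicit)
next
  case (bump j m)
  then show ?case unfolding bs_bump by (intro dir_avg_nonneg continuous_on_bs)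
qed

text \<open>The open interval from \<open>L\<close> to \<open>U\<close> has to meet the closed one
  from \<open>x - 1\<close> to \<open>x\<close>; the midpoint of the intersection is a common
  point.\<close>

lemma exists_between_shifted:
  fixes L :: real
  shows "(\<exists>s\<in>{0..1}. L < x - s \<and> x - s < U) \<longleftrightarrow> L < x \<and> x < U + 1 \<and> L < U"
proof
  assume *: "L < x \<and> x < U + 1 \<and> L < U"
  define l where "l = max L (x - 1)"
  define u where "u = min U x"
  have "L \<le> l" "x - 1 \<le> l" "l < U" "l \<le> x" "u \<le> U" "u \<le> x" "L < u" "x - 1 \<le> u"
    using * by (auto simp: l_def u_def)
  then show "\<exists>s\<in>{0..1}. L < x - s \<and> x - s < U"
    by (intro bexI[of _ "x - (l + u) / 2"]) (simp_all add: field_simps)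
qed auto

text \<open>One of the three strips that bound the hexagon is parallel to \<open>dir j\<close> and
  unaffected by the shift. The other two confine the moving coordinate to an interval, and
  eliminating \<open>s\<close> widens both by one.\<close>

lemma hexagon_bump: "x \<in> hexagon (bump j m) \<longleftrightarrow> (\<exists>s\<in>{0..1}. x - s *\<^sub>R dir j \<in> hexagon m)"
proof -
  obtain a b where x: "x = (a, b)" by (cases x)
  consider "j = 1" | "j = 2" | "j = 3" using exhaust_3 by blast
  then show ?thesis
  proof cases
    case 1
    have "(\<exists>s\<in>{0..1}. x - s *\<^sub>R dir j \<in> hexagon m) \<longleftrightarrow>
      0 < b \<and> b < real (m 2 + m 3 + 2) \<and>
      (\<exists>s\<in>{0..1}. max 0 (b - real (m 2 + 1)) < a - s \<and>
         a - s < min (real (m 1 + m 3 + 2)) (b + real (m 1 + 1)))"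
      unfolding hexagon_def x 1 by (auto intro!: bexI)
    then show ?thesis
      unfolding exists_between_shifted unfolding hexagon_def x 1 by auto
  next
    case 2
    have "(\<exists>s\<in>{0..1}. x - s *\<^sub>R dir j \<in> hexagon m) \<longleftrightarrow>
      0 < a \<and> a < real (m 1 + m 3 + 2) \<and>
      (\<exists>s\<in>{0..1}. max 0 (a - real (m 1 + 1)) < b - s \<and>
         b - s < min (real (m 2 + m 3 + 2)) (a + real (m 2 + 1)))"
      unfolding hexagon_def x 2 by (auto intro!: bexI)
    then show ?thesis
      unfolding exists_between_shifted unfolding hexagon_def x 2 by auto
  next
    case 3
    have "(\<exists>s\<in>{0..1}. x - s *\<^sub>R dir j \<in> hexagon m) \<longleftrightarrow>
      - real (m 2 + 1) < a - b \<and> a - b < real (m 1 + 1) \<and>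
      (\<exists>s\<in>{0..1}. max 0 (a - b) < a - s \<and>
         a - s < min (real (m 1 + m 3 + 2)) (a - b + real (m 2 + m 3 + 2)))"
      unfolding hexagon_def x 3 by (auto intro!: bexI)
    then show ?thesis
      unfolding exists_between_shifted unfolding hexagon_def x 3 by auto
  qed
qed

text \<open>The mean of a continuous nonnegative function over a segment vanishes only if the
  function vanishes on the whole segment, so the support grows exactly as in
  \<open>hexagon_bump\<close>.\<close>

lemma bs_nonzero_iff: "bs m x \<noteq> 0 \<longleftrightarrow> x \<in> hexagon m"
proof (induction m arbitrary: x rule: bump_induct)
  case zero
  obtain a b where x: "x = (a, b)" by (cases x)
  have "max 0 (1 - r) \<noteq> 0 \<longleftrightarrow> r < 1" for r :: real by (auto simp: max_def)
  then have "bs (\<lambda>_. 0) x \<noteq> 0 \<longleftrightarrow> \<bar>a - 1\<bar> < 1 \<and> \<bar>b - 1\<bar> < 1 \<and> \<bar>a - b\<bar> < 1"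
    unfolding x bs_zero courant_hat_explicit by simp
  also have "\<dots> \<longleftrightarrow> x \<in> hexagon (\<lambda>_. 0)"
    unfolding x hexagon_def by (simp add: abs_less_iff) argo
  finally show ?case .
next
  case (bump j m)
  then show ?case
    unfolding bs_bump hexagon_bump by (simp add: dir_avg_eq_0_iff continuous_on_bs bs_nonneg)
qed

lemma bs_eq_0: "x \<notin> hexagon m \<Longrightarrow> bs m x = 0"
  using bs_nonzero_iff by blast

section \<open>Series of integer translates\<close>

definition emb :: "int \<times> int \<Rightarrow> point" where
  "emb v = (of_int (fst v), of_int (snd v))"

definition idir :: "3 \<Rightarrow> int \<times> int" where
  "idir i = (if i = 1 then (1, 0) else if i = 2 then (0, 1) else (1, 1))"

lemma idir_simps [simp]: "idir 1 = (1, 0)" "idir 2 = (0, 1)" "idir 3 = (1, 1)"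
  by (auto simp: idir_def)

lemma emb_idir: "emb (idir i) = dir i"
  by (simp add: emb_def idir_def dir_def)

lemma emb_add: "emb (v + w) = emb v + emb w"
  by (simp add: emb_def)

lemma emb_diff: "emb (v - w) = emb v - emb w"
  by (simp add: emb_def)

lemma inj_emb: "inj emb"
  by (auto simp: inj_def emb_def prod_eq_iff)

lemma range_emb: "range emb = lattice"
proof
  show "range emb \<subseteq> lattice" by (auto simp: emb_def)
  show "lattice \<subseteq> range emb"
  proof
    fix v :: point assume "v \<in> lattice"
    then obtain p q :: int where "v = (of_int p, of_int q)" by (auto elim!: Ints_cases)
    then have "v = emb (p, q)" by (simp add: emb_def)
    then show "v \<in> range emb" by blast
  qed
qed

lemma finite_translates:
  assumes "bounded B"
  shows "finite {v. \<exists>x\<in>B. x - emb v \<in> hexagon m}"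
proof -
  obtain R where R: "\<And>x. x \<in> B \<Longrightarrow> norm x \<le> R" using assms bounded_iff by metis
  define K where "K = \<lceil>R\<rceil> + int (m 1 + m 2 + m 3 + 2)"
  have "v \<in> {-K..K} \<times> {-K..K}" if "x \<in> B" "x - emb v \<in> hexagon m" for x v
  proof -
    obtain a b where x: "x = (a, b)" by (cases x)
    obtain p q where v: "v = (p, q)" by (cases v)
    have ab: "a \<le> R" "- a \<le> R" "b \<le> R" "- b \<le> R"
      using R[OF that(1)] norm_fst_le[of a b] norm_snd_le[of b a] by (auto simp: x)
    have pq: "0 < a - p" "a - p < m 1 + m 3 + 2" "0 < b - q" "b - q < m 2 + m 3 + 2"
      using that(2) by (auto simp: hexagon_def emb_def x v)
    have K: "R + real (m 1) + real (m 2) + real (m 3) + 2 \<le> real_of_int K"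
      by (simp add: K_def)
    have "real_of_int p \<le> real_of_int K" using ab(1) pq(1) K by simp
    moreover have "real_of_int q \<le> real_of_int K" using ab(3) pq(3) K by simp
    moreover have "real_of_int (- K) \<le> real_of_int p" using ab(2) pq(2) K by simp
    moreover have "real_of_int (- K) \<le> real_of_int q" using ab(4) pq(4) K by simp
    ultimately have "p \<le> K" "q \<le> K" "- K \<le> p" "- K \<le> q" by (simp_all only: of_int_le_iff)
    then show ?thesis by (simp add: v)
  qed
  then have "{v. \<exists>x\<in>B. x - emb v \<in> hexagon m} \<subseteq> {-K..K} \<times> {-K..K}" by blast
  then show ?thesis by (rule finite_subset) simp
qed

text \<open>The index set depends on \<open>x\<close>, so every sum is finite while \<open>c\<close>
  may be any family on the whole lattice.\<close>

definition spl :: "(3 \<Rightarrow> nat) \<Rightarrow> (int \<times> int \<Rightarrow> real) \<Rightarrow> point \<Rightarrow> real" where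
  "spl m c x = (\<Sum>v | x - emb v \<in> hexagon m. c v * bs m (x - emb v))"

lemma spl_eq_sum:
  assumes "finite F" and "\<And>v. x - emb v \<in> hexagon m \<Longrightarrow> c v = 0 \<or> v \<in> F"
  shows "spl m c x = (\<Sum>v\<in>F. c v * bs m (x - emb v))"
proof -
  have fin: "finite {v. x - emb v \<in> hexagon m}"
    using finite_translates[of "{x}" m] by simp
  show ?thesis
    unfolding spl_def using assms bs_eq_0
    by (intro sum.mono_neutral_cong[OF assms(1) fin]) auto
qed

lemma spl_locally_finite:
  assumes "bounded B"
  obtains F where "finite F" and "\<And>x. x \<in> B \<Longrightarrow> spl m c x = (\<Sum>v\<in>F. c v * bs m (x - emb v))"
proof
  show "finite {v. \<exists>x\<in>B. x - emb v \<in> hexagon m}" by (rule finite_translates[OF assms])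
  then show "spl m c x = (\<Sum>v | \<exists>x\<in>B. x - emb v \<in> hexagon m. c v * bs m (x - emb v))"
    if "x \<in> B" for x using that by (intro spl_eq_sum) auto
qed

lemma continuous_on_spl: "continuous_on A (spl m c)"
proof -
  have "isCont (spl m c) x" for x
  proof -
    obtain F where "finite F" and
      F: "\<And>y. y \<in> ball x 1 \<Longrightarrow> spl m c y = (\<Sum>v\<in>F. c v * bs m (y - emb v))"
      using spl_locally_finite[OF bounded_ball[of x 1]] by metis
    have "continuous_on (ball x 1) (\<lambda>y. \<Sum>v\<in>F. c v * bs m (y - emb v))"
      by (intro continuous_intros continuous_on_compose2[OF continuous_on_bs[of UNIV]]) auto
    then have "continuous_on (ball x 1) (spl m c)"
      using F by (subst continuous_on_cong[OF refl F]) auto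
    then show ?thesis by (simp add: continuous_on_interior)
  qed
  then show ?thesis by (intro continuous_at_imp_continuous_on) auto
qed

lemma spl_bump: "spl (bump j m) c = dir_avg j (spl m c)"
proof
  fix x
  define B where "B = (\<lambda>s. x - s *\<^sub>R dir j) ` {0..1}"
  have "compact B" unfolding B_def by (intro compact_continuous_image continuous_intros) auto
  \<comment> \<open>One finite index set for the whole segment of integration allows sum and
    integral to be exchanged.\<close>
  define G where "G = {v. \<exists>y\<in>B. y - emb v \<in> hexagon m}"
  have "finite G"
    unfolding G_def using compact_imp_bounded[OF \<open>compact B\<close>] by (rule finite_translates)
  have G: "spl m c y = (\<Sum>v\<in>G. c v * bs m (y - emb v))" if "y \<in> B" for y
    using that \<open>finite G\<close> unfolding G_def by (intro spl_eq_sum) auto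
  have "spl (bump j m) c x = (\<Sum>v\<in>G. c v * bs (bump j m) (x - emb v))"
    using \<open>finite G\<close> unfolding G_def hexagon_bump
    by (intro spl_eq_sum) (auto simp: B_def hexagon_bump algebra_simps)
  also have "\<dots> = (\<Sum>v\<in>G. integral {0..1} (\<lambda>s. c v * bs m (x - s *\<^sub>R dir j - emb v)))"
    by (simp add: bs_bump dir_avg_def algebra_simps)
  also have "\<dots> = integral {0..1} (\<lambda>s. \<Sum>v\<in>G. c v * bs m (x - s *\<^sub>R dir j - emb v))"
    by (intro integral_sum[symmetric] \<open>finite G\<close> integrable_continuous_real continuous_intros
        continuous_on_compose2[OF continuous_on_bs[of UNIV]]) auto
  also have "\<dots> = dir_avg j (spl m c) x"
    unfolding dir_avg_def by (intro integral_cong G[symmetric]) (auto simp: B_def)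
  finally show "spl (bump j m) c x = dir_avg j (spl m c) x" .
qed

lemma spl_diff: "spl m (\<lambda>v. c v - c' v) x = spl m c x - spl m c' x"
  by (simp add: spl_def algebra_simps sum_subtractf)

lemma spl_shift: "spl m (\<lambda>v. c (v - w)) x = spl m c (x - emb w)"
  unfolding spl_def
  by (rule sum.reindex_bij_witness[of _ "\<lambda>v. v + w" "\<lambda>v. v - w"])
    (auto simp: emb_add emb_diff algebra_simps)

section \<open>Coefficient differences and directional derivatives\<close>

definition nabla :: "3 \<Rightarrow> (int \<times> int \<Rightarrow> real) \<Rightarrow> int \<times> int \<Rightarrow> real" where
  "nabla j c v = c v - c (v - idir j)"

lemma spl_nabla: "spl m (nabla j c) x = spl m c x - spl m c (x - dir j)"
  by (simp add: nabla_def[abs_def] spl_diff spl_shift emb_idir)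

text \<open>Along a line the average is the difference \<open>\<Phi> r - \<Phi> (r - 1)\<close> of
  an antiderivative, so continuity of \<open>f\<close> suffices to differentiate it.\<close>

lemma dir_avg_has_derivative:
  assumes "continuous_on UNIV f"
  shows "((\<lambda>s. dir_avg j f (x + s *\<^sub>R dir j)) has_real_derivative f x - f (x - dir j)) (at 0)"
proof -
  define \<phi> where "\<phi> u = f (x + u *\<^sub>R dir j)" for u :: real
  \<comment> \<open>The interval contains in its interior all arguments \<open>r - s\<close> with
    \<open>r\<close> between -1 and 1 and \<open>s\<close> in the unit interval, so that two-sided
    derivatives of \<open>\<Phi>\<close> are available.\<close>
  have "continuous_on {-3..3} \<phi>"
    unfolding \<phi>_def by (intro continuous_on_compose2[OF assms] continuous_intros) auto
  then obtain \<Phi> where *: "\<And>u. u \<in> {-3..3} \<Longrightarrow> (\<Phi> has_vector_derivative \<phi> u) (at u within {-3..3})"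
    using antiderivative_continuous by blast
  have \<Phi>: "(\<Phi> has_real_derivative \<phi> u) (at u)" if "-3 < u" "u < 3" for u
    using *[of u] that at_within_Icc_at[of "-3" u 3]
    by (simp add: has_real_derivative_iff_has_vector_derivative)
  have avg: "dir_avg j f (x + r *\<^sub>R dir j) = \<Phi> r - \<Phi> (r - 1)" if r: "-1 < r" "r < 1" for r
  proof -
    have "((\<lambda>s. \<phi> (r - s)) has_integral - \<Phi> (r - 1) - (- \<Phi> (r - 0))) {0..1}"
    proof (rule fundamental_theorem_of_calculus)
      fix s :: real assume "s \<in> {0..1}"
      then have "((\<lambda>s. - \<Phi> (r - s)) has_real_derivative \<phi> (r - s)) (at s)"
        using r DERIV_chain2[OF \<Phi>, of "\<lambda>s. r - s" s "-1" UNIV] DERIV_minus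
        by (fastforce intro: derivative_eq_intros)
      then show "((\<lambda>s. - \<Phi> (r - s)) has_vector_derivative \<phi> (r - s)) (at s within {0..1})"
        by (simp add: has_real_derivative_iff_has_vector_derivative has_vector_derivative_at_within)
    qed simp
    then have "integral {0..1} (\<lambda>s. \<phi> (r - s)) = \<Phi> r - \<Phi> (r - 1)"
      by (simp add: integral_unique)
    then show ?thesis by (simp add: dir_avg_def \<phi>_def algebra_simps)
  qed
  have "((\<lambda>r::real. r - 1) has_real_derivative 1) (at 0)"
    by (auto intro!: derivative_eq_intros)
  then have "((\<lambda>r. \<Phi> (r - 1)) has_real_derivative \<phi> (0 - 1)) (at 0)"
    using DERIV_chain2[OF \<Phi>, of "\<lambda>r. r - 1" 0 1 UNIV] by simp
  from DERIV_diff[OF \<Phi>[of 0] this]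
  have "((\<lambda>r. \<Phi> r - \<Phi> (r - 1)) has_real_derivative \<phi> 0 - \<phi> (0 - 1)) (at 0)"
    by simp
  then have "((\<lambda>s. dir_avg j f (x + s *\<^sub>R dir j)) has_real_derivative \<phi> 0 - \<phi> (0 - 1)) (at 0)"
    by (rule has_field_derivative_transform_within_open[of _ _ _ "{-1<..<1}"])
      (auto simp: avg)
  then show ?thesis by (simp add: \<phi>_def)
qed

lemma spl_has_derivative:
  "((\<lambda>s. spl (bump j m) c (x + s *\<^sub>R dir j)) has_real_derivative spl m (nabla j c) x) (at 0)"
  unfolding spl_bump spl_nabla by (rule dir_avg_has_derivative) (rule continuous_on_spl)

section \<open>Coefficients that are constant along a direction\<close>

definition invariant :: "3 \<Rightarrow> (int \<times> int \<Rightarrow> real) \<Rightarrow> bool" where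
  "invariant j c \<longleftrightarrow> (\<forall>v. c (v + idir j) = c v)"

text \<open>The spline \<open>spl (\<lambda>_. 0) c\<close> interpolates the values \<open>c\<close>, shifted by \<open>(1, 1)\<close>, linearly on each triangle.\<close>

lemma spl_zero_lower:
  assumes "0 \<le> \<eta>" "\<eta> \<le> \<xi>" "\<xi> < 1"
  shows "spl (\<lambda>_. 0) c (of_int a + \<xi>, of_int b + \<eta>) =
    (1 - \<xi>) * c (a - 1, b - 1) + (\<xi> - \<eta>) * c (a, b - 1) + \<eta> * c (a, b)"
proof -
  have "spl (\<lambda>_. 0) c (of_int a + \<xi>, of_int b + \<eta>) =
    (\<Sum>v\<in>{(a - 1, b - 1), (a, b - 1), (a, b)}. c v * bs (\<lambda>_. 0) ((of_int a + \<xi>, of_int b + \<eta>) - emb v))"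
  proof (rule spl_eq_sum)
    fix v assume *: "(of_int a + \<xi>, of_int b + \<eta>) - emb v \<in> hexagon (\<lambda>_. 0)"
    obtain p q where v: "v = (p, q)" by (cases v)
    define P Q where "P = a - p" and "Q = b - q"
    have "0 < P + \<xi>" "P + \<xi> < 2" "0 < Q + \<eta>" "Q + \<eta> < 2" "-1 < P + \<xi> - (Q + \<eta>)" "P + \<xi> - (Q + \<eta>) < 1"
      using * by (auto simp: hexagon_def emb_def v P_def Q_def)
    then have "real_of_int (- 1) < P" "real_of_int P < of_int 2" "real_of_int (- 1) < Q" "real_of_int Q < of_int 2"
      "real_of_int (- 2) < of_int (P - Q)" "real_of_int (P - Q) < of_int 1"
      using assms by simp_all
    then have "-1 < P" "P < 2" "-1 < Q" "Q < 2" "-2 < P - Q" "P - Q < 1"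
      unfolding of_int_less_iff by blast+
    then have "(P = 0 \<and> Q = 0) \<or> (P = 0 \<and> Q = 1) \<or> (P = 1 \<and> Q = 1)" by arith
    then show "c v = 0 \<or> v \<in> {(a - 1, b - 1), (a, b - 1), (a, b)}"
      by (auto simp: v P_def Q_def)
  qed simp
  then show ?thesis
    using assms by (simp add: bs_zero emb_def courant_hat_explicit)
qed

lemma spl_zero_upper:
  assumes "0 \<le> \<xi>" "\<xi> \<le> \<eta>" "\<eta> < 1"
  shows "spl (\<lambda>_. 0) c (of_int a + \<xi>, of_int b + \<eta>) =
    (1 - \<eta>) * c (a - 1, b - 1) + (\<eta> - \<xi>) * c (a - 1, b) + \<xi> * c (a, b)"
proof -
  have "spl (\<lambda>_. 0) c (of_int a + \<xi>, of_int b + \<eta>) =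
    (\<Sum>v\<in>{(a - 1, b - 1), (a - 1, b), (a, b)}. c v * bs (\<lambda>_. 0) ((of_int a + \<xi>, of_int b + \<eta>) - emb v))"
  proof (rule spl_eq_sum)
    fix v assume *: "(of_int a + \<xi>, of_int b + \<eta>) - emb v \<in> hexagon (\<lambda>_. 0)"
    obtain p q where v: "v = (p, q)" by (cases v)
    define P Q where "P = a - p" and "Q = b - q"
    have "0 < P + \<xi>" "P + \<xi> < 2" "0 < Q + \<eta>" "Q + \<eta> < 2" "-1 < P + \<xi> - (Q + \<eta>)" "P + \<xi> - (Q + \<eta>) < 1"
      using * by (auto simp: hexagon_def emb_def v P_def Q_def)
    then have "real_of_int (- 1) < P" "real_of_int P < of_int 2" "real_of_int (- 1) < Q" "real_of_int Q < of_int 2"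
      "real_of_int (- 1) < of_int (P - Q)" "real_of_int (P - Q) < of_int 2"
      using assms by simp_all
    then have "-1 < P" "P < 2" "-1 < Q" "Q < 2" "-1 < P - Q" "P - Q < 2"
      unfolding of_int_less_iff by blast+
    then have "(P = 0 \<and> Q = 0) \<or> (P = 1 \<and> Q = 0) \<or> (P = 1 \<and> Q = 1)" by arith
    then show "c v = 0 \<or> v \<in> {(a - 1, b - 1), (a - 1, b), (a, b)}"
      by (auto simp: v P_def Q_def)
  qed simp
  then show ?thesis
    using assms by (simp add: bs_zero emb_def courant_hat_explicit)
qed

lemma spl_zero_emb: "spl (\<lambda>_. 0) c (emb v) = c (v - (1, 1))"
  using spl_zero_lower[of 0 0 c "fst v" "snd v"] by (cases v) (simp add: emb_def)

lemma invariant_line: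
  assumes "invariant j c"
  shows "c (fst v + k * fst (idir j), snd v + k * snd (idir j)) = c v"
proof (induction k rule: int_induct[of _ 0])
  case base
  then show ?case by simp
next
  case (step1 k)
  then show ?case
    using assms[unfolded invariant_def, rule_format, of "(fst v + k * fst (idir j), snd v + k * snd (idir j))"]
    by (simp add: plus_prod_def algebra_simps)
next
  case (step2 k)
  then show ?case
    using assms[unfolded invariant_def, rule_format, of "(fst v + (k - 1) * fst (idir j), snd v + (k - 1) * snd (idir j))"]
    by (simp add: plus_prod_def algebra_simps)
qed

text \<open>Invariant coefficients reduce to a sequence \<open>g\<close>, and the spline becomes the
  piecewise linear interpolant \<open>\<gamma>\<close> of \<open>g\<close> in a coordinate that is
  constant along \<open>dir j\<close>.\<close>

lemma spl_zero_invariant: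
  assumes "invariant j c"
  shows "spl (\<lambda>_. 0) c (x - s *\<^sub>R dir j) = spl (\<lambda>_. 0) c x"
proof -
  have cell: "\<exists>a b \<xi> \<eta>. x = (of_int a + \<xi>, of_int b + \<eta>) \<and> 0 \<le> \<xi> \<and> \<xi> < 1 \<and> 0 \<le> \<eta> \<and> \<eta> < 1" for x :: point
    by (rule exI[of _ "\<lfloor>fst x\<rfloor>"], rule exI[of _ "\<lfloor>snd x\<rfloor>"], rule exI[of _ "frac (fst x)"], rule exI[of _ "frac (snd x)"])
      (simp add: frac_def prod_eq_iff, linarith)
  consider "j = 1" | "j = 2" | "j = 3" using exhaust_3 by blast
  then show ?thesis
  proof cases
    case 1
    define g where "g k = c (0, k)" for k
    have c: "c (p, q) = g q" for p q
      using invariant_line[OF assms, of "(0, q)" p] by (simp add: 1 g_def)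
    define \<gamma> where "\<gamma> y = (1 - frac y) * g (\<lfloor>y\<rfloor> - 1) + frac y * g \<lfloor>y\<rfloor>" for y :: real
    have "spl (\<lambda>_. 0) c x = \<gamma> (snd x)" for x
    proof -
      obtain a b \<xi> \<eta> where x: "x = (of_int a + \<xi>, of_int b + \<eta>)" and
        *: "0 \<le> \<xi>" "\<xi> < 1" "0 \<le> \<eta>" "\<eta> < 1" using cell by blast
      have "\<lfloor>snd x\<rfloor> = b" using * by (simp add: x floor_eq_iff)
      then have "\<gamma> (snd x) = (1 - \<eta>) * g (b - 1) + \<eta> * g b" by (simp add: \<gamma>_def frac_def x)
      then show ?thesis
        using * spl_zero_lower[of \<eta> \<xi> c a b] spl_zero_upper[of \<xi> \<eta> c a b]
        by (cases "\<eta> \<le> \<xi>") (simp_all add: x[symmetric] c, simp_all add: algebra_simps)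
    qed
    then show ?thesis using 1 by simp
  next
    case 2
    define g where "g k = c (k, 0)" for k
    have c: "c (p, q) = g p" for p q
      using invariant_line[OF assms, of "(p, 0)" q] by (simp add: 2 g_def)
    define \<gamma> where "\<gamma> y = (1 - frac y) * g (\<lfloor>y\<rfloor> - 1) + frac y * g \<lfloor>y\<rfloor>" for y :: real
    have "spl (\<lambda>_. 0) c x = \<gamma> (fst x)" for x
    proof -
      obtain a b \<xi> \<eta> where x: "x = (of_int a + \<xi>, of_int b + \<eta>)" and
        *: "0 \<le> \<xi>" "\<xi> < 1" "0 \<le> \<eta>" "\<eta> < 1" using cell by blast
      have "\<lfloor>fst x\<rfloor> = a" using * by (simp add: x floor_eq_iff)
      then have "\<gamma> (fst x) = (1 - \<xi>) * g (a - 1) + \<xi> * g a" by (simp add: \<gamma>_def frac_def x)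
      then show ?thesis
        using * spl_zero_lower[of \<eta> \<xi> c a b] spl_zero_upper[of \<xi> \<eta> c a b]
        by (cases "\<eta> \<le> \<xi>") (simp_all add: x[symmetric] c, simp_all add: algebra_simps)
    qed
    then show ?thesis using 2 by simp
  next
    case 3
    define g where "g k = c (k, 0)" for k
    have c: "c (p, q) = g (p - q)" for p q
      using invariant_line[OF assms, of "(p - q, 0)" q] by (simp add: 3 g_def)
    \<comment> \<open>The hat with index \<open>(p, q)\<close> peaks at
      \<open>(p + 1, q + 1)\<close>. This shift cancels in the difference of the coordinates, so
      \<open>g\<close> is not offset by one as in the other two cases.\<close>
    define \<gamma> where "\<gamma> y = (1 - frac y) * g \<lfloor>y\<rfloor> + frac y * g (\<lfloor>y\<rfloor> + 1)" for y :: real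
    have "spl (\<lambda>_. 0) c x = \<gamma> (fst x - snd x)" for x
    proof -
      obtain a b \<xi> \<eta> where x: "x = (of_int a + \<xi>, of_int b + \<eta>)" and
        *: "0 \<le> \<xi>" "\<xi> < 1" "0 \<le> \<eta>" "\<eta> < 1" using cell by blast
      show ?thesis
      proof (cases "\<eta> \<le> \<xi>")
        case True
        have fl: "\<lfloor>fst x - snd x\<rfloor> = a - b" using * True by (simp add: x floor_eq_iff)
        then have "\<gamma> (fst x - snd x) = (1 - (\<xi> - \<eta>)) * g (a - b) + (\<xi> - \<eta>) * g (a - b + 1)"
          unfolding \<gamma>_def frac_def fl by (simp add: x)
        then show ?thesis
          using spl_zero_lower[of \<eta> \<xi> c a b] * True
          by (simp add: x[symmetric] c) (simp add: algebra_simps)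
      next
        case False
        have fl: "\<lfloor>fst x - snd x\<rfloor> = a - b - 1" using * False by (simp add: x floor_eq_iff)
        then have "\<gamma> (fst x - snd x) = (\<eta> - \<xi>) * g (a - b - 1) + (1 - (\<eta> - \<xi>)) * g (a - b)"
          unfolding \<gamma>_def frac_def fl by (simp add: x)
        then show ?thesis
          using spl_zero_upper[of \<xi> \<eta> c a b] * False
          by (simp add: x[symmetric] c) (simp add: algebra_simps)
      qed
    qed
    then show ?thesis using 3 by simp
  qed
qed

lemma spl_invariant:
  assumes "invariant j c"
  shows "spl m c (x - s *\<^sub>R dir j) = spl m c x"
proof (induction m arbitrary: x rule: bump_induct)
  case zero
  then show ?case using spl_zero_invariant[OF assms] .
next
  case (bump k m)
  have "spl m c (x - t *\<^sub>R dir k - s *\<^sub>R dir j) = spl m c (x - t *\<^sub>R dir k)" for t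
    by (rule bump)
  then show ?case unfolding spl_bump dir_avg_def by (simp add: algebra_simps)
qed

lemma spl_bump_invariant:
  assumes "invariant j c"
  shows "spl (bump j m) c = spl m c"
  by (simp add: spl_bump dir_avg_def fun_eq_iff spl_invariant[OF assms])

section \<open>Polynomials vanishing to higher order on an edge\<close>

text \<open>Induction over the formation of polynomials. The total derivative yields the derivatives
  along all three \<open>dir i\<close>, and since \<open>p1\<close> and \<open>p2\<close> are again
  polynomial, differentiation can be iterated.\<close>

lemma real_polynomial_function_has_gradient:
  fixes p :: "point \<Rightarrow> real"
  assumes "real_polynomial_function p"
  shows "\<exists>p1 p2. real_polynomial_function p1 \<and> real_polynomial_function p2 \<and>
    (\<forall>x. (p has_derivative (\<lambda>h. fst h * p1 x + snd h * p2 x)) (at x))"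
  using assms
proof (induction rule: real_polynomial_function.induct)
  case (linear f)
  have "f h = fst h * f (1, 0) + snd h * f (0, 1)" for h
  proof -
    have "f h = f (fst h *\<^sub>R (1, 0) + snd h *\<^sub>R (0, 1))" by simp
    then show ?thesis
      using linear by (simp only: bounded_linear.linear linear_add linear_scale) simp
  qed
  then have "f = (\<lambda>h. fst h * f (1, 0) + snd h * f (0, 1))" by blast
  then have "(f has_derivative (\<lambda>h. fst h * f (1, 0) + snd h * f (0, 1))) (at x)" for x
    using bounded_linear_imp_has_derivative[OF linear, of "at x"] by simp
  then show ?case by (intro exI[of _ "\<lambda>_. f (1, 0)"] exI[of _ "\<lambda>_. f (0, 1)"]) auto
next
  case (const c)
  show ?case by (intro exI[of _ "\<lambda>_. 0"]) auto
next
  case (add f g)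
  then obtain f1 f2 g1 g2 where
    "real_polynomial_function f1" "real_polynomial_function f2"
    "real_polynomial_function g1" "real_polynomial_function g2" and
    f: "\<And>x. (f has_derivative (\<lambda>h. fst h * f1 x + snd h * f2 x)) (at x)" and
    g: "\<And>x. (g has_derivative (\<lambda>h. fst h * g1 x + snd h * g2 x)) (at x)" by blast
  then show ?case
    by (intro exI[of _ "\<lambda>x. f1 x + g1 x"] exI[of _ "\<lambda>x. f2 x + g2 x"])
      (auto intro!: derivative_eq_intros f g simp: algebra_simps)
next
  case (mult f g)
  then obtain f1 f2 g1 g2 where
    "real_polynomial_function f1" "real_polynomial_function f2"
    "real_polynomial_function g1" "real_polynomial_function g2" and
    f: "\<And>x. (f has_derivative (\<lambda>h. fst h * f1 x + snd h * f2 x)) (at x)" and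
    g: "\<And>x. (g has_derivative (\<lambda>h. fst h * g1 x + snd h * g2 x)) (at x)" by blast
  with mult.hyps show ?case
    by (intro exI[of _ "\<lambda>x. f x * g1 x + f1 x * g x"] exI[of _ "\<lambda>x. f x * g2 x + f2 x * g x"])
      (auto intro!: derivative_eq_intros f g simp: algebra_simps)
qed

lemma has_derivative_along:
  assumes "(p has_derivative p') (at (x + t *\<^sub>R v))"
  shows "((\<lambda>s. p (x + s *\<^sub>R v)) has_real_derivative p' v) (at t)"
proof -
  have "((\<lambda>s. x + s *\<^sub>R v) has_vector_derivative v) (at t)"
    by (auto intro!: derivative_eq_intros)
  from vector_derivative_diff_chain_within[OF this has_derivative_at_withinI[OF assms]]
  show ?thesis by (simp add: o_def has_real_derivative_iff_has_vector_derivative)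
qed

lemma partial_deriv_gradient:
  assumes "(p has_derivative (\<lambda>h. fst h * a + snd h * b)) (at x)"
  shows "partial_deriv i p x = fst (dir i) * a + snd (dir i) * b"
  using has_derivative_along[of p _ x 0 "dir i"] assms
  unfolding partial_deriv_def by (intro DERIV_imp_deriv) simp

lemma polynomial_partial_deriv [intro]:
  assumes "real_polynomial_function p"
  shows "real_polynomial_function (partial_deriv i p)"
proof -
  obtain p1 p2 where *: "real_polynomial_function p1" "real_polynomial_function p2"
    "\<And>x. (p has_derivative (\<lambda>h. fst h * p1 x + snd h * p2 x)) (at x)"
    using real_polynomial_function_has_gradient[OF assms] by blast
  have "partial_deriv i p = (\<lambda>x. fst (dir i) * p1 x + snd (dir i) * p2 x)"
    by (rule ext) (rule partial_deriv_gradient[OF *(3)])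
  then show ?thesis
    using *(1,2) by (auto intro!: real_polynomial_function.intros(3,4) real_polynomial_function.intros(2))
qed

lemma polynomial_has_partial_deriv:
  assumes "real_polynomial_function p"
  shows "((\<lambda>s. p (x + s *\<^sub>R dir i)) has_real_derivative partial_deriv i p (x + t *\<^sub>R dir i)) (at t)"
proof -
  obtain p1 p2 where *: "\<And>x. (p has_derivative (\<lambda>h. fst h * p1 x + snd h * p2 x)) (at x)"
    using real_polynomial_function_has_gradient[OF assms] by blast
  show ?thesis
    using has_derivative_along[OF *, where x = x and t = t and v = "dir i"]
    by (simp only: partial_deriv_gradient[OF *, of i "x + t *\<^sub>R dir i"])
qed

lemma partial_deriv_eqI:
  assumes "((\<lambda>s. p (x + s *\<^sub>R dir i)) has_real_derivative D) (at 0)"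
  shows "partial_deriv i p x = D"
  unfolding partial_deriv_def by (rule DERIV_imp_deriv) fact

lemma partial_deriv_3:
  assumes "real_polynomial_function p"
  shows "partial_deriv 3 p = (\<lambda>x. partial_deriv 1 p x + partial_deriv 2 p x)"
proof -
  obtain p1 p2 where *: "\<And>x. (p has_derivative (\<lambda>h. fst h * p1 x + snd h * p2 x)) (at x)"
    using real_polynomial_function_has_gradient[OF assms] by blast
  show ?thesis by (rule ext) (simp add: partial_deriv_gradient[OF *])
qed

lemma partial_deriv_add:
  assumes "real_polynomial_function p" "real_polynomial_function q"
  shows "partial_deriv i (\<lambda>x. p x + q x) = (\<lambda>x. partial_deriv i p x + partial_deriv i q x)"
proof
  fix x
  show "partial_deriv i (\<lambda>x. p x + q x) x = partial_deriv i p x + partial_deriv i q x"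
    using DERIV_add[OF polynomial_has_partial_deriv[OF assms(1), of x i 0]
        polynomial_has_partial_deriv[OF assms(2), of x i 0]]
    by (intro partial_deriv_eqI) simp
qed

lemma partial_deriv_diff:
  assumes "real_polynomial_function p" "real_polynomial_function q"
  shows "partial_deriv i (\<lambda>x. p x - q x) = (\<lambda>x. partial_deriv i p x - partial_deriv i q x)"
proof
  fix x
  show "partial_deriv i (\<lambda>x. p x - q x) x = partial_deriv i p x - partial_deriv i q x"
    using DERIV_diff[OF polynomial_has_partial_deriv[OF assms(1), of x i 0]
        polynomial_has_partial_deriv[OF assms(2), of x i 0]]
    by (intro partial_deriv_eqI) simp
qed

lemma partial_deriv_mult:
  assumes "real_polynomial_function p" "real_polynomial_function q"
  shows "partial_deriv i (\<lambda>x. p x * q x) = (\<lambda>x. partial_deriv i p x * q x + p x * partial_deriv i q x)"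
proof
  fix x
  show "partial_deriv i (\<lambda>x. p x * q x) x = partial_deriv i p x * q x + p x * partial_deriv i q x"
    using DERIV_mult[OF polynomial_has_partial_deriv[OF assms(1), of x i 0]
        polynomial_has_partial_deriv[OF assms(2), of x i 0]]
    by (intro partial_deriv_eqI) (simp add: algebra_simps)
qed

lemma partial_deriv_const: "partial_deriv i (\<lambda>_. c) = (\<lambda>_. 0)"
  by (auto intro!: partial_deriv_eqI derivative_eq_intros)

lemma partial_deriv_linear:
  assumes "bounded_linear f"
  shows "partial_deriv i f = (\<lambda>_. f (dir i))"
proof
  fix x
  show "partial_deriv i f x = f (dir i)"
    using has_derivative_along[OF bounded_linear_imp_has_derivative[OF assms], where x = x and t = 0 and v = "dir i"]
    by (intro partial_deriv_eqI)
qed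

lemma partial_deriv_commute:
  assumes "real_polynomial_function p"
  shows "partial_deriv i (partial_deriv j p) = partial_deriv j (partial_deriv i p)"
  using assms
proof (induction rule: real_polynomial_function.induct)
  case (linear f)
  then show ?case by (simp add: partial_deriv_linear partial_deriv_const)
next
  case (const c)
  then show ?case by (simp add: partial_deriv_const)
next
  case (add f g)
  then show ?case by (simp add: partial_deriv_add polynomial_partial_deriv)
next
  case (mult f g)
  then show ?case
    by (simp add: partial_deriv_add partial_deriv_mult polynomial_partial_deriv
        real_polynomial_function.intros(4) algebra_simps)
qed

text \<open>The recursion strips one derivative at a time, which suits induction on the order;
  \<open>vanishes_iff_funpow\<close> recovers the form used in \<open>spline_space\<close>.\<close>

primrec vanishes :: "nat \<Rightarrow> (point \<Rightarrow> real) \<Rightarrow> point set \<Rightarrow> bool" where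
  "vanishes 0 p E \<longleftrightarrow> (\<forall>x\<in>E. p x = 0)"
| "vanishes (Suc d) p E \<longleftrightarrow> (\<forall>x\<in>E. p x = 0) \<and>
     vanishes d (partial_deriv 1 p) E \<and> vanishes d (partial_deriv 2 p) E"

lemma vanishes_zero: "vanishes d p E \<Longrightarrow> x \<in> E \<Longrightarrow> p x = 0"
  by (cases d) auto

lemma vanishes_Suc_imp: "vanishes (Suc d) p E \<Longrightarrow> vanishes d p E"
proof (induction d arbitrary: p)
  case (Suc d)
  from Suc.prems show ?case by (auto simp only: vanishes.simps(2)[of "Suc d"] vanishes.simps(2)[of d p] intro: Suc.IH)
qed simp

lemma vanishes_antimono: "vanishes d p E \<Longrightarrow> d' \<le> d \<Longrightarrow> vanishes d' p E"
proof (induction d)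
  case (Suc d)
  then show ?case
    using vanishes_Suc_imp[OF Suc.prems(1)] by (cases "d' = Suc d") (simp_all del: vanishes.simps)
qed simp

lemma vanishes_add:
  assumes "real_polynomial_function p" "real_polynomial_function q"
    and "vanishes d p E" "vanishes d q E"
  shows "vanishes d (\<lambda>x. p x + q x) E"
  using assms by (induction d arbitrary: p q) (auto simp: partial_deriv_add)

lemma vanishes_diff:
  assumes "real_polynomial_function p" "real_polynomial_function q"
    and "vanishes d p E" "vanishes d q E"
  shows "vanishes d (\<lambda>x. p x - q x) E"
  using assms by (induction d arbitrary: p q) (auto simp: partial_deriv_diff)

lemma vanishes_partial_deriv:
  assumes "real_polynomial_function p" and "vanishes (Suc d) p E"
  shows "vanishes d (partial_deriv i p) E"
  using assms exhaust_3[of i]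
  by (auto simp: partial_deriv_3 polynomial_partial_deriv intro!: vanishes_add)

lemma vanishes_iff_funpow:
  assumes "real_polynomial_function p"
  shows "vanishes d p E \<longleftrightarrow>
    (\<forall>a b. a + b \<le> d \<longrightarrow> (\<forall>x\<in>E. (partial_deriv 1 ^^ a) ((partial_deriv 2 ^^ b) p) x = 0))"
  using assms
proof (induction d arbitrary: p)
  case (Suc d)
  have poly: "real_polynomial_function ((partial_deriv 2 ^^ b) p)" for b
    by (induction b) (auto simp: Suc.prems)
  \<comment> \<open>\<open>vanishes\<close> applies derivatives in any order, whereas the iterated
    form applies those along \<open>dir 2\<close> first.\<close>
  have comm: "(partial_deriv 2 ^^ b) (partial_deriv 1 p) = partial_deriv 1 ((partial_deriv 2 ^^ b) p)" for b
    by (induction b) (auto simp: partial_deriv_commute[OF poly, of 2 1])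
  show ?case (is "_ \<longleftrightarrow> ?R")
  proof
    assume "vanishes (Suc d) p E"
    then have v: "\<forall>x\<in>E. p x = 0" "vanishes d (partial_deriv 1 p) E" "vanishes d (partial_deriv 2 p) E" by auto
    show ?R
    proof (intro allI impI ballI)
      fix a b x assume ab: "a + b \<le> Suc d" and x: "x \<in> E"
      show "(partial_deriv 1 ^^ a) ((partial_deriv 2 ^^ b) p) x = 0"
      proof (cases b)
        case 0
        show ?thesis
        proof (cases a)
          case (Suc a')
          then show ?thesis
            using Suc.IH[of "partial_deriv 1 p", THEN iffD1, rule_format, of a' 0 x] v(2) x ab 0 Suc.prems
            by (auto simp: funpow_Suc_right simp del: funpow.simps(2))
        qed (use 0 v(1) x in simp)
      next
        case (Suc b')
        then show ?thesis
          using Suc.IH[of "partial_deriv 2 p", THEN iffD1, rule_format, of a b' x] v(3) x ab Suc.prems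
          by (auto simp: funpow_Suc_right simp del: funpow.simps(2))
      qed
    qed
  next
    assume R: ?R
    have "(partial_deriv 1 ^^ a) ((partial_deriv 2 ^^ b) (partial_deriv 2 p)) x = 0"
      "(partial_deriv 1 ^^ a) ((partial_deriv 2 ^^ b) (partial_deriv 1 p)) x = 0"
      if "a + b \<le> d" "x \<in> E" for a b x
      using R[rule_format, of a "Suc b" x] R[rule_format, of "Suc a" b x] that
      by (simp_all add: comm funpow_Suc_right del: funpow.simps)
    then show "vanishes (Suc d) p E"
      using R[rule_format, of 0 0] Suc.IH Suc.prems by (auto simp: polynomial_partial_deriv)
  qed
qed simp

text \<open>A function that is zero on the edge has zero derivative along it, and the partial
  derivatives of \<open>p\<close> inherit this for higher orders. Thus differentiation along the
  edge costs no order.\<close>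

lemma vanishes_tangential:
  assumes "real_polynomial_function p" and "vanishes d p (closed_segment w (w + dir i))"
  shows "vanishes d (partial_deriv i p) (closed_segment w (w + dir i))"
  using assms
proof (induction d arbitrary: p)
  case 0
  show ?case
  proof (simp, rule ballI)
    fix x assume "x \<in> closed_segment w (w + dir i)"
    then obtain t where t: "0 \<le> t" "t \<le> 1" "x = w + t *\<^sub>R dir i"
      by (auto simp: in_segment algebra_simps)
    have zero: "p (w + s *\<^sub>R dir i) = 0" if "s \<in> {0..1}" for s
    proof -
      have "w + s *\<^sub>R dir i \<in> closed_segment w (w + dir i)"
        using that by (auto simp: in_segment algebra_simps intro!: exI[of _ s])
      then show ?thesis using 0(2) by simp
    qed
    \<comment> \<open>Derivatives within the parameter interval also cover the end points of the
      edge.\<close>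
    have "((\<lambda>s. p (w + s *\<^sub>R dir i)) has_vector_derivative partial_deriv i p x) (at t within {0..1})"
      using polynomial_has_partial_deriv[OF 0(1), of w i t] t(3)
      by (simp add: has_real_derivative_iff_has_vector_derivative has_vector_derivative_at_within)
    moreover have "((\<lambda>s. p (w + s *\<^sub>R dir i)) has_vector_derivative 0) (at t within {0..1})"
      using t(1,2) zero
      by (intro has_vector_derivative_transform[OF _ _ has_vector_derivative_const[of 0]]) simp_all
    ultimately show "partial_deriv i p x = 0"
      using t(1,2) vector_derivative_unique_within_closed_interval[of 0 1 t] by simp
  qed
next
  case (Suc d)
  have "vanishes d (partial_deriv i (partial_deriv k p)) (closed_segment w (w + dir i))" if "k \<in> {1, 2}" for k
    using Suc that by (intro Suc.IH) auto
  moreover have "\<forall>x\<in>closed_segment w (w + dir i). partial_deriv i p x = 0"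
    using Suc.IH[OF Suc.prems(1) vanishes_Suc_imp[OF Suc.prems(2)]] vanishes_zero by blast
  ultimately show ?case
    using Suc.prems(1) by (simp add: partial_deriv_commute[of p i])
qed

text \<open>\<open>dir i\<close> and \<open>dir j\<close> span the plane, so both coordinate
  derivatives are combinations of the derivatives along these two. The one along the edge is
  supplied by \<open>vanishes_tangential\<close>.\<close>

lemma vanishes_SucI:
  assumes p: "real_polynomial_function p" and "i \<noteq> j"
    and zero: "\<forall>x\<in>closed_segment w (w + dir i). p x = 0"
    and j: "vanishes d (partial_deriv j p) (closed_segment w (w + dir i))"
  shows "vanishes (Suc d) p (closed_segment w (w + dir i))"
proof -
  \<comment> \<open>The orders are climbed one by one: the tangential derivative is handled at order
    \<open>e\<close> only once \<open>p\<close> is known to vanish to that order.\<close>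
  have "vanishes e p (closed_segment w (w + dir i))" if "e \<le> Suc d" for e
    using that
  proof (induction e)
    case 0
    then show ?case using zero by simp
  next
    case (Suc e)
    have i: "vanishes e (partial_deriv i p) (closed_segment w (w + dir i))"
      using Suc by (intro vanishes_tangential p) auto
    have j: "vanishes e (partial_deriv j p) (closed_segment w (w + dir i))"
      using Suc.prems by (intro vanishes_antimono[OF j]) simp
    have poly: "real_polynomial_function (partial_deriv k p)" for k using p by auto
    have "vanishes e (partial_deriv 1 p) (closed_segment w (w + dir i))"
      if "vanishes e (partial_deriv 3 p) (closed_segment w (w + dir i))"
        "vanishes e (partial_deriv 2 p) (closed_segment w (w + dir i))"
      using vanishes_diff[OF poly poly that] by (simp add: partial_deriv_3[OF p])
    moreover have "vanishes e (partial_deriv 2 p) (closed_segment w (w + dir i))"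
      if "vanishes e (partial_deriv 3 p) (closed_segment w (w + dir i))"
        "vanishes e (partial_deriv 1 p) (closed_segment w (w + dir i))"
      using vanishes_diff[OF poly poly that] by (simp add: partial_deriv_3[OF p])
    ultimately have "vanishes e (partial_deriv 1 p) (closed_segment w (w + dir i)) \<and>
        vanishes e (partial_deriv 2 p) (closed_segment w (w + dir i))"
      using i j \<open>i \<noteq> j\<close> exhaust_3[of i] exhaust_3[of j] by metis
    then show ?case using zero by simp
  qed
  then show ?thesis by blast
qed

section \<open>Splines on two adjacent triangles\<close>

text \<open>In contrast to \<open>bump_induct\<close>, the hypothesis is available for all
  predecessors of \<open>m\<close> at once, as statements about derivatives in every direction
  require.\<close>

lemma bump_less_induct [case_names less]:
  assumes "\<And>m. (\<And>j m'. m = bump j m' \<Longrightarrow> P m') \<Longrightarrow> P m"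
  shows "P m"
proof (induction "\<Sum>k\<in>UNIV. m k" arbitrary: m rule: less_induct)
  case less
  show ?case
  proof (rule assms)
    fix j m' assume m: "m = bump j m'"
    have "(\<Sum>k\<in>UNIV. m' k) < (\<Sum>k\<in>UNIV. m k)"
      unfolding m by (intro sum_strict_mono_ex1) auto
    then show "P m'" by (rule less)
  qed
qed

text \<open>The entry of the smoothness vector \<open>d\<close> for direction \<open>i\<close>, with
  \<open>m j\<close> for \<open>n $ j - 1\<close>: the sum over the two directions transversal to
  the edge.\<close>

definition order_across :: "3 \<Rightarrow> (3 \<Rightarrow> nat) \<Rightarrow> nat" where
  "order_across i m = (if i = 1 then m 2 + m 3 else if i = 2 then m 1 + m 3 else m 1 + m 2)"

lemma order_across_bump:
  "order_across i (bump j m) = (if j = i then order_across i m else Suc (order_across i m))"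
  using exhaust_3[of i] exhaust_3[of j] by (auto simp: order_across_def)

lemma order_across_SucE:
  assumes "order_across i m = Suc d"
  obtains j m' where "j \<noteq> i" "m = bump j m'" "order_across i m' = d"
proof -
  have "\<exists>j. j \<noteq> i \<and> m j \<noteq> 0"
  proof (rule ccontr)
    assume "\<not> ?thesis"
    then have "i = 1 \<or> m 1 = 0" and "i = 2 \<or> m 2 = 0" and "i = 3 \<or> m 3 = 0" by auto
    then show False using assms exhaust_3[of i] by (elim disjE) (simp_all add: order_across_def)
  qed
  then obtain j where j: "j \<noteq> i" "m j \<noteq> 0" by blast
  define m' where "m' = m(j := m j - 1)"
  have m: "m = bump j m'" using j(2) by (auto simp: m'_def)
  have "order_across i m' = d"
    using assms j(1) unfolding m order_across_bump by simp
  with j(1) m show ?thesis by (rule that)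
qed

abbreviation edge :: "3 \<Rightarrow> int \<times> int \<Rightarrow> point set" where
  "edge i w \<equiv> closed_segment (emb w) (emb w + dir i)"

lemma eq_on_closure:
  fixes f g :: "point \<Rightarrow> real"
  assumes "continuous_on UNIV f" "continuous_on UNIV g"
    and "\<And>x. x \<in> t \<Longrightarrow> f x = g x" and "x \<in> closure t"
  shows "f x = g x"
proof -
  have "continuous_on (closure t) (\<lambda>x. f x - g x)"
    using continuous_on_diff[OF assms(1,2)] by (rule continuous_on_subset) simp
  then have "f x - g x = 0"
    by (rule continuous_constant_on_closure[OF _ _ assms(4)]) (simp add: assms(3))
  then show ?thesis by simp
qed

lemma continuous_on_polynomial:
  fixes p :: "point \<Rightarrow> real"
  shows "real_polynomial_function p \<Longrightarrow> continuous_on A p"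
  using continuous_on_polymonial_function real_polynomial_function_eq by blast

lemma partial_deriv_cong_open:
  assumes "open t" and "x \<in> t" and "\<And>x. x \<in> t \<Longrightarrow> f x = g x"
  shows "partial_deriv i f x = partial_deriv i g x"
proof -
  have "open ((\<lambda>s. x + s *\<^sub>R dir i) -` t)"
    by (intro open_vimage assms continuous_intros)
  then have "\<forall>\<^sub>F s in nhds 0. s \<in> (\<lambda>s. x + s *\<^sub>R dir i) -` t"
    using assms(2) by (intro eventually_nhds_in_open) auto
  then have "\<forall>\<^sub>F s in nhds 0. f (x + s *\<^sub>R dir i) = g (x + s *\<^sub>R dir i)"
    by eventually_elim (simp add: assms(3))
  then show ?thesis unfolding partial_deriv_def by (rule deriv_cong_ev) simp
qed

lemma partial_deriv_piece:
  assumes "open t" and "x \<in> t" and "\<And>x. x \<in> t \<Longrightarrow> f x = spl (bump j m) c x"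
  shows "partial_deriv j f x = spl m (nabla j c) x"
  by (rule trans[OF partial_deriv_cong_open[OF assms] partial_deriv_eqI[OF spl_has_derivative]])

text \<open>Order zero is continuity of the common spline. Otherwise the spline can be
  differentiated along some direction transversal to the edge; both pieces become pieces of one
  spline of lower order, and \<open>vanishes_SucI\<close> regains the lost order.\<close>

lemma equal_coefficients_imp_vanishes:
  assumes "open t" "open t'" "edge i w \<subseteq> closure t" "edge i w \<subseteq> closure t'"
    and "real_polynomial_function f" "real_polynomial_function f'"
    and "\<And>x. x \<in> t \<Longrightarrow> f x = spl m c x" "\<And>x. x \<in> t' \<Longrightarrow> f' x = spl m c x"
  shows "vanishes (order_across i m) (\<lambda>x. f x - f' x) (edge i w)"
  using assms(5-8)
proof (induction "order_across i m" arbitrary: m c f f')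
  case (0 m c f f')
  have "f x = spl m c x \<and> f' x = spl m c x" if "x \<in> edge i w" for x
    using that assms(3,4) 0 by (blast intro: eq_on_closure continuous_on_spl continuous_on_polynomial)
  then show ?case by (simp add: 0(1)[symmetric])
next
  case (Suc d m c f f')
  obtain j m' where j: "j \<noteq> i" and m: "m = bump j m'" and d: "order_across i m' = d"
    using order_across_SucE[OF Suc(2)[symmetric]] .
  have "vanishes (order_across i m') (\<lambda>x. partial_deriv j f x - partial_deriv j f' x) (edge i w)"
  proof (rule Suc(1)[OF d[symmetric]])
    show "partial_deriv j f x = spl m' (nabla j c) x" if "x \<in> t" for x
      using partial_deriv_piece[OF assms(1) that] Suc.prems(3) unfolding m by blast
    show "partial_deriv j f' x = spl m' (nabla j c) x" if "x \<in> t'" for x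
      using partial_deriv_piece[OF assms(2) that] Suc.prems(4) unfolding m by blast
  qed (use Suc.prems in auto)
  moreover have "f x = spl m c x \<and> f' x = spl m c x" if "x \<in> edge i w" for x
    using that assms(3,4) Suc.prems
    by (blast intro: eq_on_closure continuous_on_spl continuous_on_polynomial)
  ultimately have "vanishes (Suc d) (\<lambda>x. f x - f' x) (edge i w)"
    using j Suc.prems d
    by (intro vanishes_SucI[of _ i j]) (auto simp: partial_deriv_diff)
  then show ?case using Suc(2) by simp
qed

section \<open>Formal vanishing on an edge\<close>

text \<open>
  Since \<open>spl m' (nabla j c)\<close> is the derivative of \<open>spl (bump j m') c\<close> along \<open>dir j\<close>, this says that on \<open>E\<close>
  the spline and all its derivatives of order at most \<open>m j\<close> in each direction \<open>j\<close> vanish.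
\<close>

inductive formally_zero :: "point set \<Rightarrow> (3 \<Rightarrow> nat) \<Rightarrow> (int \<times> int \<Rightarrow> real) \<Rightarrow> bool" for E where
  formally_zeroI: "(\<And>x. x \<in> E \<Longrightarrow> spl m c x = 0) \<Longrightarrow>
    (\<And>j m'. m = bump j m' \<Longrightarrow> formally_zero E m' (nabla j c)) \<Longrightarrow> formally_zero E m c"

lemma formally_zero_spl: "formally_zero E m c \<Longrightarrow> x \<in> E \<Longrightarrow> spl m c x = 0"
  by (erule formally_zero.cases) simp

lemma formally_zero_nabla: "formally_zero E (bump j m) c \<Longrightarrow> formally_zero E m (nabla j c)"
  by (erule formally_zero.cases) simp

lemma nabla_diff: "nabla j (\<lambda>v. c v - c' v) = (\<lambda>v. nabla j c v - nabla j c' v)"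
  by (simp add: nabla_def fun_eq_iff)

text \<open>A derivative along the edge keeps both the order of vanishing and
  \<open>order_across\<close>, a transversal one lowers both by one, so the hypothesis persists down
  the recursion. The triangles may coincide, which serves local linear independence.\<close>

lemma vanishes_imp_formally_zero:
  assumes "open t" "open t'" "edge i w \<subseteq> closure t" "edge i w \<subseteq> closure t'"
    and "real_polynomial_function f" "real_polynomial_function f'"
    and "\<And>x. x \<in> t \<Longrightarrow> f x = spl m c x" "\<And>x. x \<in> t' \<Longrightarrow> f' x = spl m c' x"
    and "vanishes (order_across i m) (\<lambda>x. f x - f' x) (edge i w)"
  shows "formally_zero (edge i w) m (\<lambda>v. c v - c' v)"
  using assms(5-9)
proof (induction m arbitrary: c c' f f' rule: bump_less_induct)
  case (less m)
  note poly = less.prems(1,2)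
  show ?case
  proof (rule formally_zeroI)
    fix x assume x: "x \<in> edge i w"
    have "f x = spl m c x" "f' x = spl m c' x"
      using x assms(3,4) less.prems
      by (blast intro: eq_on_closure continuous_on_spl continuous_on_polynomial)+
    then show "spl m (\<lambda>v. c v - c' v) x = 0"
      using vanishes_zero[OF less.prems(5) x] by (simp add: spl_diff)
  next
    fix j m' assume m: "m = bump j m'"
    have f: "partial_deriv j f x = spl m' (nabla j c) x" if "x \<in> t" for x
      using partial_deriv_piece[OF assms(1) that] less.prems(3) unfolding m by blast
    have f': "partial_deriv j f' x = spl m' (nabla j c') x" if "x \<in> t'" for x
      using partial_deriv_piece[OF assms(2) that] less.prems(4) unfolding m by blast
    have "vanishes (order_across i m') (partial_deriv j (\<lambda>x. f x - f' x)) (edge i w)"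
    proof (cases "j = i")
      case True
      then show ?thesis
        using less.prems(5) poly unfolding m order_across_bump
        by (auto intro!: vanishes_tangential)
    next
      case False
      then show ?thesis
        using less.prems(5) poly unfolding m order_across_bump
        by (auto intro!: vanishes_partial_deriv simp del: vanishes.simps)
    qed
    then show "formally_zero (edge i w) m' (nabla j (\<lambda>v. c v - c' v))"
      unfolding nabla_diff partial_deriv_diff[OF poly]
      using polynomial_partial_deriv[OF poly(1)] polynomial_partial_deriv[OF poly(2)] f f'
      by (intro less.IH[OF m, of "partial_deriv j f" "partial_deriv j f'"]) simp_all
  qed
qed

section \<open>Translates active on an edge\<close>

text \<open>
  The translates that do not vanish identically on \<open>edge i w\<close>, that is, those that are positive at its
  midpoint \<open>emb w + dir i / 2\<close>. The inequalities defining the hexagon are multiplied by 2 to stay in \<open>\<int>\<close>.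
\<close>

definition edge_active :: "3 \<Rightarrow> int \<times> int \<Rightarrow> (3 \<Rightarrow> nat) \<Rightarrow> (int \<times> int) set" where
  "edge_active i w m = {v.
     (let X = 2 * (fst w - fst v) + fst (idir i); Y = 2 * (snd w - snd v) + snd (idir i) in
       0 < X \<and> X < 2 * int (m 1 + m 3 + 2) \<and> 0 < Y \<and> Y < 2 * int (m 2 + m 3 + 2) \<and>
       - 2 * int (m 2 + 1) < X - Y \<and> X - Y < 2 * int (m 1 + 1))}"

lemma edge_active_simps:
  "(p, q) \<in> edge_active 1 (a, b) m \<longleftrightarrow> p \<le> a \<and> a - p \<le> int (m 1 + m 3 + 1) \<and>
     q < b \<and> b - q \<le> int (m 2 + m 3 + 1) \<and> - int (m 2 + 1) \<le> a - p - (b - q) \<and> a - p - (b - q) \<le> int (m 1)"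
  "(p, q) \<in> edge_active 2 (a, b) m \<longleftrightarrow> p < a \<and> a - p \<le> int (m 1 + m 3 + 1) \<and>
     q \<le> b \<and> b - q \<le> int (m 2 + m 3 + 1) \<and> - int (m 2) \<le> a - p - (b - q) \<and> a - p - (b - q) \<le> int (m 1 + 1)"
  "(p, q) \<in> edge_active 3 (a, b) m \<longleftrightarrow> p \<le> a \<and> a - p \<le> int (m 1 + m 3 + 1) \<and>
     q \<le> b \<and> b - q \<le> int (m 2 + m 3 + 1) \<and> - int (m 2) \<le> a - p - (b - q) \<and> a - p - (b - q) \<le> int (m 1)"
  by (auto simp: edge_active_def Let_def)

lemma of_int_less_add_unitD:
  fixes \<tau> :: real
  assumes "0 \<le> \<tau>" "\<tau> \<le> 1"
  shows "of_int k < of_int l + \<tau> \<Longrightarrow> k \<le> l" and "of_int l + \<tau> < of_int k \<Longrightarrow> l < k"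
  using assms by linarith+

lemma edge_active_if_nonzero:
  assumes "x \<in> edge i w" "x - emb v \<in> hexagon m"
  shows "v \<in> edge_active i w m"
proof -
  obtain \<tau> where \<tau>: "0 \<le> \<tau>" "\<tau> \<le> 1" and x: "x = emb w + \<tau> *\<^sub>R dir i"
    using assms(1) by (auto simp: in_segment algebra_simps)
  obtain p q a b where v: "v = (p, q)" and w: "w = (a, b)" by (cases v, cases w)
  consider "i = 1" | "i = 2" | "i = 3" using exhaust_3 by blast
  then show ?thesis
  proof cases
    case 1
    have "real_of_int 0 < of_int (a - p) + \<tau>" "of_int (a - p) + \<tau> < real_of_int (int (m 1 + m 3 + 2))"
      "real_of_int 0 < of_int (b - q)" "of_int (b - q) < real_of_int (int (m 2 + m 3 + 2))"
      "real_of_int (- int (m 2 + 1)) < of_int (a - p - (b - q)) + \<tau>"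
      "of_int (a - p - (b - q)) + \<tau> < real_of_int (int (m 1 + 1))"
      using assms(2) by (auto simp: 1 hexagon_def x v w emb_def)
    then have "0 \<le> a - p" "a - p < int (m 1 + m 3 + 2)" "0 < b - q" "b - q < int (m 2 + m 3 + 2)"
      "- int (m 2 + 1) \<le> a - p - (b - q)" "a - p - (b - q) < int (m 1 + 1)"
      using of_int_less_add_unitD[OF \<tau>] of_int_less_iff by blast+
    then show ?thesis unfolding 1 v w edge_active_simps by simp
  next
    case 2
    have "real_of_int 0 < of_int (b - q) + \<tau>" "of_int (b - q) + \<tau> < real_of_int (int (m 2 + m 3 + 2))"
      "real_of_int 0 < of_int (a - p)" "of_int (a - p) < real_of_int (int (m 1 + m 3 + 2))"
      "real_of_int (- int (m 1 + 1)) < of_int (b - q - (a - p)) + \<tau>"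
      "of_int (b - q - (a - p)) + \<tau> < real_of_int (int (m 2 + 1))"
      using assms(2) by (auto simp: 2 hexagon_def x v w emb_def)
    then have "0 \<le> b - q" "b - q < int (m 2 + m 3 + 2)" "0 < a - p" "a - p < int (m 1 + m 3 + 2)"
      "- int (m 1 + 1) \<le> b - q - (a - p)" "b - q - (a - p) < int (m 2 + 1)"
      using of_int_less_add_unitD[OF \<tau>] of_int_less_iff by blast+
    then show ?thesis unfolding 2 v w edge_active_simps by simp
  next
    case 3
    have "real_of_int 0 < of_int (b - q) + \<tau>" "of_int (b - q) + \<tau> < real_of_int (int (m 2 + m 3 + 2))"
      "real_of_int 0 < of_int (a - p) + \<tau>" "of_int (a - p) + \<tau> < real_of_int (int (m 1 + m 3 + 2))"
      "real_of_int (- int (m 2 + 1)) < of_int (a - p - (b - q))"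
      "of_int (a - p - (b - q)) < real_of_int (int (m 1 + 1))"
      using assms(2) by (auto simp: 3 hexagon_def x v w emb_def)
    then have "0 \<le> b - q" "b - q < int (m 2 + m 3 + 2)" "0 \<le> a - p" "a - p < int (m 1 + m 3 + 2)"
      "- int (m 2 + 1) < a - p - (b - q)" "a - p - (b - q) < int (m 1 + 1)"
      using of_int_less_add_unitD[OF \<tau>] of_int_less_iff by blast+
    then show ?thesis unfolding 3 v w edge_active_simps by simp
  qed
qed

lemma edge_active_bumpI:
  assumes "v \<in> edge_active i w m"
  shows "v \<in> edge_active i w (bump j m)" and "v - idir j \<in> edge_active i w (bump j m)"
  using assms exhaust_3[of i] exhaust_3[of j]
  by (cases v; cases w; auto simp: edge_active_simps)+

text \<open>On a line along \<open>dir j\<close> the active indices form an interval, and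
  \<open>bump j\<close> adds one index at its lower end without reaching new lines.\<close>

lemma edge_active_bumpD:
  assumes "v \<in> edge_active i w (bump j m)"
  shows "v \<in> edge_active i w m \<or> v + idir j \<in> edge_active i w m"
  using assms exhaust_3[of i] exhaust_3[of j]
  by (cases v; cases w; auto simp: edge_active_simps)

text \<open>Only the lowest index of a line is lost when the order drops. An index with an active
  predecessor survives, so the lower level controls \<open>nabla j c\<close> there.\<close>

lemma edge_active_bump_consecutive:
  assumes "v \<in> edge_active i w (bump j m)" "v - idir j \<in> edge_active i w (bump j m)"
  shows "v \<in> edge_active i w m"
  using assms exhaust_3[of i] exhaust_3[of j]
  by (cases v; cases w; auto simp: edge_active_simps)

definition along :: "3 \<Rightarrow> int \<Rightarrow> int \<times> int \<Rightarrow> int \<times> int" where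
  "along j k v = (fst v + k * fst (idir j), snd v + k * snd (idir j))"

lemma along_0 [simp]: "along j 0 v = v"
  by (simp add: along_def)

lemma along_add: "along j k (along j l v) = along j (k + l) v"
  by (simp add: along_def algebra_simps)

lemma along_1: "along j 1 v = v + idir j"
  by (simp add: along_def plus_prod_def)

lemma edge_active_along:
  assumes "v \<in> edge_active i w m" "along j k v \<in> edge_active i w m" "0 \<le> l" "l \<le> k"
  shows "along j l v \<in> edge_active i w m"
  using assms exhaust_3[of i] exhaust_3[of j]
  by (cases v; cases w; auto simp: edge_active_simps along_def)

text \<open>Only the hats peaking at the two end points remain, the one with index \<open>v\<close>
  at \<open>v + (1, 1)\<close>.\<close>

lemma edge_active_zero:
  assumes "v \<in> edge_active i w (\<lambda>_. 0)"
  shows "v + (1, 1) = w \<or> v + (1, 1) = w + idir i"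
  using assms exhaust_3[of i]
  by (cases v; cases w; auto simp: edge_active_simps)

lemma spl_edge_cong:
  assumes "\<And>v. v \<in> edge_active i w m \<Longrightarrow> c v = c' v" and "x \<in> edge i w"
  shows "spl m c x = spl m c' x"
  unfolding spl_def using assms edge_active_if_nonzero by (intro sum.cong) auto

text \<open>Formal vanishing reads only coefficients active on the edge: \<open>nabla j c\<close> at
  an index active for \<open>m'\<close> involves two indices active for \<open>bump j m'\<close>.
  This allows \<open>c\<close> to be replaced by an invariant family.\<close>

lemma formally_zero_cong:
  assumes "formally_zero (edge i w) m c" and "\<And>v. v \<in> edge_active i w m \<Longrightarrow> c v = c' v"
  shows "formally_zero (edge i w) m c'"
  using assms
proof (induction arbitrary: c' rule: formally_zero.induct)
  case (formally_zeroI m c)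
  show ?case
  proof (rule formally_zero.formally_zeroI)
    fix x assume "x \<in> edge i w"
    then show "spl m c' x = 0"
      using spl_edge_cong[OF formally_zeroI.prems] formally_zeroI.hyps(1) by simp
  next
    fix j m' assume m: "m = bump j m'"
    show "formally_zero (edge i w) m' (nabla j c')"
    proof (rule formally_zeroI.IH[OF m])
      fix v assume "v \<in> edge_active i w m'"
      then have "c v = c' v" "c (v - idir j) = c' (v - idir j)"
        using formally_zeroI.prems edge_active_bumpI unfolding m by blast+
      then show "nabla j c v = nabla j c' v" by (simp add: nabla_def)
    qed
  qed
qed

lemma invariant_nabla: "invariant j c \<Longrightarrow> invariant j (nabla k c)"
  unfolding invariant_def nabla_def by (metis add_diff_eq diff_add_eq)

text \<open>An invariant coefficient family has the same spline at both levels, so the conditions at level \<open>bump j m\<close> pass down.\<close>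

lemma formally_zero_invariant:
  assumes "formally_zero E (bump j m) c" and "invariant j c"
  shows "formally_zero E m c"
  using assms
proof (induction m arbitrary: c rule: bump_less_induct)
  case (less m)
  show ?case
  proof (rule formally_zeroI)
    show "spl m c x = 0" if "x \<in> E" for x
      using formally_zero_spl[OF less.prems(1) that] by (simp only: spl_bump_invariant[OF less.prems(2)])
  next
    fix k m' assume m: "m = bump k m'"
    have "formally_zero E (bump k (bump j m')) c"
      using less.prems(1) unfolding m bump_commute[where j = k and k = j] .
    then show "formally_zero E m' (nabla k c)"
      by (intro less.IH[OF m] formally_zero_nabla invariant_nabla less.prems)
  qed
qed

text \<open>\<open>A\<close> meets every line along \<open>dir j\<close> in an interval, so equality
  of neighbours makes \<open>c\<close> constant there, and a chosen element of \<open>A\<close>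
  supplies the value for the whole line.\<close>

lemma invariant_extension:
  assumes convex: "\<And>v k l. v \<in> A \<Longrightarrow> along j k v \<in> A \<Longrightarrow> 0 \<le> l \<Longrightarrow> l \<le> k \<Longrightarrow> along j l v \<in> A"
    and const: "\<And>v. v \<in> A \<Longrightarrow> v + idir j \<in> A \<Longrightarrow> c (v + idir j) = c v"
  obtains c' where "invariant j c'" and "\<And>v. v \<in> A \<Longrightarrow> c' v = c v"
proof
  define line where "line v = {u \<in> A. \<exists>k. u = along j k v}" for v
  have step: "c (along j (int k) v) = c v" if "v \<in> A" "along j (int k) v \<in> A" for v k
    using that
  proof (induction k)
    case (Suc k)
    have "along j (int k) v \<in> A" using convex[OF Suc.prems] by simp
    moreover have "along j (int (Suc k)) v = along j (int k) v + idir j"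
      unfolding along_1[symmetric] along_add by (simp add: add.commute)
    ultimately show ?case using Suc const by metis
  qed simp
  have eq: "c u = c v" if uv: "u \<in> line v" "v \<in> A" for u v
  proof -
    obtain k where k: "u \<in> A" "u = along j k v" using uv(1) by (auto simp: line_def)
    show ?thesis
    proof (cases "0 \<le> k")
      case True
      then show ?thesis using step[of v "nat k"] k uv(2) by simp
    next
      case False
      then show ?thesis using step[of u "nat (- k)"] k uv(2) by (simp add: along_add)
    qed
  qed
  have "line (v + idir j) = line v" for v
  proof -
    have "(\<exists>k. u = along j k (v + idir j)) \<longleftrightarrow> (\<exists>k. u = along j k v)" for u
      unfolding along_1[symmetric] along_add by (metis add.commute diff_add_cancel)
    then show ?thesis by (simp add: line_def)
  qed
  \<comment> \<open>A line that misses \<open>A\<close> receives an unspecified value, still the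
    same for all its points because it depends on the set \<open>line v\<close> alone.\<close>
  then show "invariant j (\<lambda>v. c (SOME u. u \<in> line v))" by (simp add: invariant_def)
  show "c (SOME u. u \<in> line v) = c v" if "v \<in> A" for v
  proof -
    have "v \<in> line v" using that by (auto simp: line_def intro: exI[of _ 0])
    then have "(SOME u. u \<in> line v) \<in> line v" by (rule someI)
    then show ?thesis using eq that by blast
  qed
qed

lemma formally_zero_imp_zero:
  assumes "formally_zero (edge i w) m c" and "v \<in> edge_active i w m"
  shows "c v = 0"
  using assms
proof (induction m arbitrary: c v rule: bump_induct)
  case zero
  \<comment> \<open>The end points of the edge are lattice points, where the interpolating spline
    returns a coefficient.\<close>
  have "spl (\<lambda>_. 0) c (emb u) = 0" if "u = w \<or> u = w + idir i" for u
    using that formally_zero_spl[OF zero(1), of "emb u"] by (auto simp: emb_add emb_idir)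
  then show ?case
    using edge_active_zero[OF zero(2)] spl_zero_emb[of c "v + (1, 1)"] by simp
next
  case (bump j m)
  let ?A = "edge_active i w (bump j m)"
  have const: "c (u + idir j) = c u" if "u \<in> ?A" "u + idir j \<in> ?A" for u
  proof -
    have "u + idir j \<in> edge_active i w m"
      using that(2) by (rule edge_active_bump_consecutive) (simp add: that(1))
    then have "nabla j c (u + idir j) = 0"
      by (intro bump.IH[OF formally_zero_nabla] bump.prems)
    then show ?thesis by (simp add: nabla_def)
  qed
  \<comment> \<open>So far \<open>c\<close> is constant along \<open>dir j\<close> only among active
    indices; the inactive ones have to be changed to reach true invariance.\<close>
  obtain c' where c': "invariant j c'" "\<And>v. v \<in> ?A \<Longrightarrow> c' v = c v"
  proof (rule invariant_extension[of ?A j c])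
    show "along j l v \<in> ?A" if "v \<in> ?A" "along j k v \<in> ?A" "0 \<le> l" "l \<le> k" for v k l
      using that by (rule edge_active_along)
  qed (use const in blast)+
  \<comment> \<open>Invariance lets the formal vanishing of \<open>c'\<close> descend to
    \<open>m\<close>, where the induction hypothesis applies a second time.\<close>
  have "formally_zero (edge i w) m c'"
    by (rule formally_zero_invariant[OF formally_zero_cong[OF bump.prems(1)] c'(1)]) (rule c'(2)[symmetric])
  then have "c' u = 0" if "u \<in> edge_active i w m" for u using bump.IH that by blast
  \<comment> \<open>An index active only for \<open>bump j m\<close> has its successor active for
    \<open>m\<close>, and invariance carries the zero over.\<close>
  then have "c' v = 0"
    using edge_active_bumpD[OF bump.prems(2)] c'(1) unfolding invariant_def by metis
  then show ?case using c'(2)[OF bump.prems(2)] by simp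
qed

section \<open>Triangles and their active translates\<close>

lemma trianglesE:
  assumes "t \<in> triangles"
  obtains k u where "k \<in> {1, 2}" "t = triangle k (emb u)"
  using assms unfolding triangles_def range_emb[symmetric] by blast

lemma open_triangles: "t \<in> triangles \<Longrightarrow> open t"
  by (auto simp: triangles_def triangle_def)

lemma triangles_nonempty: "t \<in> triangles \<Longrightarrow> t \<noteq> {}"
  using triangle_nonempty by (auto simp: triangles_def)

lemma bounded_closure_triangle: "t \<in> triangles \<Longrightarrow> bounded (closure t)"
  by (elim trianglesE) (simp only: closure_triangle, intro bounded_convex_hull finite_imp_bounded, simp)

lemma edge_subset_closure_triangle:
  assumes "k \<in> {1, 2}" "i = k \<or> i = 3"
  shows "edge i u \<subseteq> closure (triangle k (emb u))"
  unfolding closure_triangle[OF assms(1)]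
  using assms(2) by (intro closed_segment_subset_convex_hull) (auto intro: hull_inc)

lemma closure_triangle_1:
  "closure (triangle 1 (emb (a, b))) = {(x, y). b \<le> y \<and> y - b \<le> x - a \<and> x - a \<le> 1}"
  by (simp only: closure_triangle[of 1] insert_iff simp_thms)
    (simp only: emb_def fst_conv snd_conv closed_triangle_1)

lemma closure_triangle_2:
  "closure (triangle 2 (emb (a, b))) = {(x, y). a \<le> x \<and> x - a \<le> y - b \<and> y - b \<le> 1}"
  by (simp only: closure_triangle[of 2] insert_iff simp_thms)
    (simp only: emb_def fst_conv snd_conv closed_triangle_2)

text \<open>Testing the two end points suffices: the inequalities between their integer coordinates
  already determine \<open>u\<close>.\<close>

lemma edge_subset_closure_triangleD:
  assumes "edge i w \<subseteq> closure (triangle k (emb u))" "k \<in> {1, 2}"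
  shows "i = 1 \<and> (k = 1 \<and> u = w \<or> k = 2 \<and> u = w - (0, 1)) \<or>
    i = 2 \<and> (k = 2 \<and> u = w \<or> k = 1 \<and> u = w - (1, 0)) \<or> i = 3 \<and> u = w"
proof -
  obtain a b c d where u: "u = (a, b)" and w: "w = (c, d)" by (cases u, cases w)
  have e: "emb w \<in> closure (triangle k (emb u))" "emb (w + idir i) \<in> closure (triangle k (emb u))"
    using assms(1) by (auto simp: emb_add emb_idir)
  consider "k = 1" | "k = 2" using assms(2) by blast
  then show ?thesis
  proof cases
    case 1
    have "of_int b \<le> real_of_int d" "real_of_int (d - b) \<le> of_int (c - a)" "real_of_int (c - a) \<le> of_int 1"
      "of_int b \<le> real_of_int (d + snd (idir i))"
      "real_of_int (d + snd (idir i) - b) \<le> of_int (c + fst (idir i) - a)"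
      "real_of_int (c + fst (idir i) - a) \<le> of_int 1"
      using e unfolding 1 u w closure_triangle_1 by (simp_all add: emb_def)
    then have "b \<le> d" "d - b \<le> c - a" "c - a \<le> 1" "b \<le> d + snd (idir i)"
      "d + snd (idir i) - b \<le> c + fst (idir i) - a" "c + fst (idir i) - a \<le> 1"
      unfolding of_int_le_iff by blast+
    then show ?thesis using exhaust_3[of i] by (elim disjE) (simp_all add: 1 u w)
  next
    case 2
    have "of_int a \<le> real_of_int c" "real_of_int (c - a) \<le> of_int (d - b)" "real_of_int (d - b) \<le> of_int 1"
      "of_int a \<le> real_of_int (c + fst (idir i))"
      "real_of_int (c + fst (idir i) - a) \<le> of_int (d + snd (idir i) - b)"
      "real_of_int (d + snd (idir i) - b) \<le> of_int 1"
      using e unfolding 2 u w closure_triangle_2 by (simp_all add: emb_def)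
    then have "a \<le> c" "c - a \<le> d - b" "d - b \<le> 1" "a \<le> c + fst (idir i)"
      "c + fst (idir i) - a \<le> d + snd (idir i) - b" "d + snd (idir i) - b \<le> 1"
      unfolding of_int_le_iff by blast+
    then show ?thesis using exhaust_3[of i] by (elim disjE) (simp_all add: 2 u w)
  qed
qed

definition cell_active :: "(3 \<Rightarrow> nat) \<Rightarrow> point set \<Rightarrow> (int \<times> int) set" where
  "cell_active m t = {v. \<exists>x\<in>closure t. x - emb v \<in> hexagon m}"

lemma cell_active_triangle_1:
  assumes "(p, q) \<in> cell_active m (triangle 1 (emb (a, b)))"
  shows "p \<le> a \<and> a - p \<le> int (m 1 + m 3 + 1) \<and> q \<le> b \<and> b - q \<le> int (m 2 + m 3 + 1) \<and>
     - int (m 2 + 1) \<le> a - p - (b - q) \<and> a - p - (b - q) \<le> int (m 1)"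
proof -
  obtain x y :: real where xy: "(x, y) - emb (p, q) \<in> hexagon m" and
    t: "b \<le> y" "y - b \<le> x - a" "x - a \<le> 1"
    using assms by (auto simp: cell_active_def closure_triangle_1)
  have "real_of_int 0 < of_int (a - p) + (x - a)" "of_int (a - p) + (x - a) < real_of_int (int (m 1 + m 3 + 2))"
    "real_of_int 0 < of_int (b - q) + (y - b)" "of_int (b - q) + (y - b) < real_of_int (int (m 2 + m 3 + 2))"
    "real_of_int (- int (m 2 + 1)) < of_int (a - p - (b - q)) + (x - a - (y - b))"
    "of_int (a - p - (b - q)) + (x - a - (y - b)) < real_of_int (int (m 1 + 1))"
    using xy by (simp_all add: hexagon_def emb_def)
  moreover have "0 \<le> x - a" "0 \<le> y - b" "y - b \<le> 1" "0 \<le> x - a - (y - b)" "x - a - (y - b) \<le> 1"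
    using t by linarith+
  ultimately have "0 \<le> a - p" "a - p < int (m 1 + m 3 + 2)" "0 \<le> b - q" "b - q < int (m 2 + m 3 + 2)"
    "- int (m 2 + 1) \<le> a - p - (b - q)" "a - p - (b - q) < int (m 1 + 1)"
    using of_int_less_add_unitD t(3) by blast+
  then show ?thesis by simp
qed

lemma cell_active_triangle_2:
  assumes "(p, q) \<in> cell_active m (triangle 2 (emb (a, b)))"
  shows "p \<le> a \<and> a - p \<le> int (m 1 + m 3 + 1) \<and> q \<le> b \<and> b - q \<le> int (m 2 + m 3 + 1) \<and>
     - int (m 2) \<le> a - p - (b - q) \<and> a - p - (b - q) \<le> int (m 1 + 1)"
proof -
  obtain x y :: real where xy: "(x, y) - emb (p, q) \<in> hexagon m" and
    t: "a \<le> x" "x - a \<le> y - b" "y - b \<le> 1"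
    using assms by (auto simp: cell_active_def closure_triangle_2)
  have "real_of_int 0 < of_int (a - p) + (x - a)" "of_int (a - p) + (x - a) < real_of_int (int (m 1 + m 3 + 2))"
    "real_of_int 0 < of_int (b - q) + (y - b)" "of_int (b - q) + (y - b) < real_of_int (int (m 2 + m 3 + 2))"
    "real_of_int (- int (m 1 + 1)) < of_int (b - q - (a - p)) + (y - b - (x - a))"
    "of_int (b - q - (a - p)) + (y - b - (x - a)) < real_of_int (int (m 2 + 1))"
    using xy by (simp_all add: hexagon_def emb_def)
  moreover have "0 \<le> y - b" "0 \<le> x - a" "x - a \<le> 1" "0 \<le> y - b - (x - a)" "y - b - (x - a) \<le> 1"
    using t by linarith+
  ultimately have "0 \<le> a - p" "a - p < int (m 1 + m 3 + 2)" "0 \<le> b - q" "b - q < int (m 2 + m 3 + 2)"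
    "- int (m 1 + 1) \<le> b - q - (a - p)" "b - q - (a - p) < int (m 2 + 1)"
    using of_int_less_add_unitD t(3) by blast+
  then show ?thesis by simp
qed

text \<open>If an index active on the triangle misses the edge of direction \<open>k\<close>, one
  coordinate difference is zero, and then the inequalities of the diagonal hold. Thus two edges see
  all active translates of the triangle.\<close>

lemma cell_active_subset:
  assumes "k \<in> {1, 2}" "v \<in> cell_active m (triangle k (emb u))"
  shows "v \<in> edge_active k u m \<or> v \<in> edge_active 3 u m"
proof -
  obtain a b p q where u: "u = (a, b)" and v: "v = (p, q)" by (cases u, cases v)
  consider "k = 1" | "k = 2" using assms(1) by blast
  then show ?thesis
  proof cases
    case 1
    show ?thesis
      using cell_active_triangle_1[of p q m a b] assms(2) unfolding 1 u v edge_active_simps by auto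
  next
    case 2
    show ?thesis
      using cell_active_triangle_2[of p q m a b] assms(2) unfolding 2 u v edge_active_simps by auto
  qed
qed

text \<open>The triangles on the two sides of an edge contribute complementary bounds, whose
  conjunction implies those of \<open>edge_active\<close>. Up to exchanging the triangles there is
  one configuration per direction.\<close>

lemma cell_active_Int_subset:
  assumes "t \<in> triangles" "t' \<in> triangles" "t \<noteq> t'"
    and "edge i w \<subseteq> closure t" "edge i w \<subseteq> closure t'"
    and "v \<in> cell_active m t" "v \<in> cell_active m t'"
  shows "v \<in> edge_active i w m"
proof -
  obtain k u where k: "k \<in> {1, 2}" "t = triangle k (emb u)" using trianglesE[OF assms(1)] .
  obtain k' u' where k': "k' \<in> {1, 2}" "t' = triangle k' (emb u')" using trianglesE[OF assms(2)] .
  obtain a b p q where w: "w = (a, b)" and v: "v = (p, q)" by (cases w, cases v)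
  note act = cell_active_triangle_1[of p q m] cell_active_triangle_2[of p q m]
  have "i = 1 \<and> v \<in> cell_active m (triangle 1 (emb w)) \<and> v \<in> cell_active m (triangle 2 (emb (w - (0, 1)))) \<or>
    i = 2 \<and> v \<in> cell_active m (triangle 2 (emb w)) \<and> v \<in> cell_active m (triangle 1 (emb (w - (1, 0)))) \<or>
    i = 3 \<and> v \<in> cell_active m (triangle 1 (emb w)) \<and> v \<in> cell_active m (triangle 2 (emb w))"
    using edge_subset_closure_triangleD[OF assms(4)[unfolded k(2)] k(1)]
      edge_subset_closure_triangleD[OF assms(5)[unfolded k'(2)] k'(1)] k(1) k'(1) assms(3,6,7)
    unfolding k(2) k'(2) insert_iff empty_iff by (elim disjE conjE) simp_all
  then show ?thesis
  proof (elim disjE conjE)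
    assume "i = 1" "v \<in> cell_active m (triangle 1 (emb w))" "v \<in> cell_active m (triangle 2 (emb (w - (0, 1))))"
    then show ?thesis
      using act(1)[of a b] act(2)[of a "b - 1"] by (simp add: v w edge_active_simps)
  next
    assume "i = 2" "v \<in> cell_active m (triangle 2 (emb w))" "v \<in> cell_active m (triangle 1 (emb (w - (1, 0))))"
    then show ?thesis
      using act(2)[of a b] act(1)[of "a - 1" b] by (simp add: v w edge_active_simps)
  next
    assume "i = 3" "v \<in> cell_active m (triangle 1 (emb w))" "v \<in> cell_active m (triangle 2 (emb w))"
    then show ?thesis
      using act(1)[of a b] act(2)[of a b] by (simp add: v w edge_active_simps)
  qed
qed

lemma vanishes_0: "vanishes d (\<lambda>_. 0) E"
  by (induction d) (simp_all add: partial_deriv_const)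

text \<open>The zero polynomial represents both pieces, with the same triangle on both sides. The
  edge result then gives zero for every index active on one of two edges, and these exhaust the
  active ones.\<close>

lemma local_linear_independence:
  assumes "t \<in> triangles" and "\<And>x. x \<in> t \<Longrightarrow> spl m c x = 0" and "v \<in> cell_active m t"
  shows "c v = 0"
proof -
  obtain k u where k: "k \<in> {1, 2}" "t = triangle k (emb u)" using trianglesE[OF assms(1)] .
  have "c v = 0" if "i = k \<or> i = 3" "v \<in> edge_active i u m" for i
  proof -
    have "edge i u \<subseteq> closure t" using edge_subset_closure_triangle[OF k(1) that(1)] k(2) by simp
    then have "formally_zero (edge i u) m (\<lambda>v. c v - 0)"
      using assms(2) open_triangles[OF assms(1)] vanishes_0
      by (intro vanishes_imp_formally_zero[of t t _ _ "\<lambda>_. 0" "\<lambda>_. 0"]) (auto simp: spl_def)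
    then show ?thesis using formally_zero_imp_zero that(2) by fastforce
  qed
  then show ?thesis using cell_active_subset[of k v m u] assms(3) k by blast
qed

section \<open>Well-definedness of the local coefficients\<close>

lemma active_eq_cell_active: "active n t = emb ` cell_active (\<lambda>j. n $ j - 1) t"
  unfolding active_def cell_active_def box_spline_eq_bs bs_nonzero_iff range_emb[symmetric] by blast

lemma finite_cell_active: "t \<in> triangles \<Longrightarrow> finite (cell_active m t)"
  unfolding cell_active_def by (intro finite_translates bounded_closure_triangle)

lemma sum_active_eq_spl:
  assumes "t \<in> triangles" "x \<in> closure t"
  shows "(\<Sum>v\<in>active n t. c v * box_spline n (x - v)) = spl (\<lambda>j. n $ j - 1) (\<lambda>v. c (emb v)) x"
proof -
  have "spl (\<lambda>j. n $ j - 1) (\<lambda>v. c (emb v)) x =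
      (\<Sum>v\<in>cell_active (\<lambda>j. n $ j - 1) t. c (emb v) * bs (\<lambda>j. n $ j - 1) (x - emb v))"
    using assms by (intro spl_eq_sum finite_cell_active) (auto simp: cell_active_def)
  then show ?thesis
    unfolding active_eq_cell_active box_spline_eq_bs
    by (simp add: sum.reindex inj_on_subset[OF inj_emb])
qed

text \<open>Coefficients exist by \<open>poly_space\<close>, with the identity extended to the
  closed triangle by continuity; uniqueness is local linear independence. Together they justify the
  definite description in \<open>spline_coeff\<close>.\<close>

lemma spline_coeff_eq_spl:
  assumes "f \<in> poly_space n" "t \<in> triangles" "x \<in> closure t"
  shows "f x = spl (\<lambda>j. n $ j - 1) (\<lambda>v. spline_coeff n t f (emb v)) x"
proof -
  let ?m = "\<lambda>j. n $ j - 1"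
  let ?P = "\<lambda>c. (\<forall>v. v \<notin> active n t \<longrightarrow> c v = 0) \<and>
     (\<forall>x\<in>closure t. f x = (\<Sum>v\<in>active n t. c v * box_spline n (x - v)))"
  have poly: "real_polynomial_function f" using assms(1) by (simp add: poly_space_def)
  obtain c0 where c0: "\<And>x. x \<in> t \<Longrightarrow> f x = (\<Sum>v\<in>active n t. c0 v * box_spline n (x - v))"
    using assms(1,2) unfolding poly_space_def by blast
  define c where "c v = (if v \<in> active n t then c0 v else 0)" for v
  have c: "(\<Sum>v\<in>active n t. c v * box_spline n (y - v)) = (\<Sum>v\<in>active n t. c0 v * box_spline n (y - v))" for y
    by (intro sum.cong) (auto simp: c_def)
  have on_t: "f y = spl ?m (\<lambda>v. c (emb v)) y" if "y \<in> t" for y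
    using c0[OF that] c[of y] sum_active_eq_spl[OF assms(2), of y c n] that closure_subset[of t] by auto
  have "f y = spl ?m (\<lambda>v. c (emb v)) y" if "y \<in> closure t" for y
    using on_t that by (rule eq_on_closure[OF continuous_on_polynomial[OF poly] continuous_on_spl])
  then have ex: "?P c" by (simp add: sum_active_eq_spl[OF assms(2)]) (simp add: c_def)
  have "c' = c" if c': "?P c'" for c'
  proof
    fix v
    show "c' v = c v"
    proof (cases "v \<in> active n t")
      case True
      then obtain u where u: "v = emb u" "u \<in> cell_active ?m t" by (auto simp: active_eq_cell_active)
      have "spl ?m (\<lambda>v. c' (emb v) - c (emb v)) y = 0" if "y \<in> t" for y
      proof -
        have "y \<in> closure t" using that closure_subset by blast
        from conjunct2[OF c', rule_format, OF this] conjunct2[OF ex, rule_format, OF this]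
        have "spl ?m (\<lambda>v. c' (emb v)) y = spl ?m (\<lambda>v. c (emb v)) y"
          unfolding sum_active_eq_spl[OF assms(2) \<open>y \<in> closure t\<close>] by (rule trans[OF sym])
        then show ?thesis unfolding spl_diff by simp
      qed
      then show ?thesis
        using local_linear_independence[OF assms(2) _ u(2)] unfolding u(1) by fastforce
    next
      case False
      then show ?thesis using conjunct1[OF c'] conjunct1[OF ex] by (cases v) simp
    qed
  qed
  with ex have "?P (spline_coeff n t f)" unfolding spline_coeff_def by (rule theI)
  then show ?thesis using sum_active_eq_spl[OF assms(2,3)] assms(3) by simp
qed

section \<open>Iterated partial derivatives of the pieces\<close>

lemma polynomial_funpow_partial_deriv [intro]:
  "real_polynomial_function p \<Longrightarrow> real_polynomial_function ((partial_deriv i ^^ a) p)"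
  by (induction a) auto

lemma funpow_partial_deriv_diff:
  assumes "real_polynomial_function p" "real_polynomial_function q"
  shows "(partial_deriv i ^^ a) (\<lambda>x. p x - q x) =
    (\<lambda>x. (partial_deriv i ^^ a) p x - (partial_deriv i ^^ a) q x)"
  using assms by (induction a) (simp_all add: partial_deriv_diff polynomial_funpow_partial_deriv)

lemma vanishes_diff_iff:
  assumes "real_polynomial_function p" "real_polynomial_function q"
  shows "vanishes d (\<lambda>x. p x - q x) E \<longleftrightarrow> (\<forall>a b. a + b \<le> d \<longrightarrow> (\<forall>x\<in>E.
    (partial_deriv 1 ^^ a) ((partial_deriv 2 ^^ b) p) x = (partial_deriv 1 ^^ a) ((partial_deriv 2 ^^ b) q) x))"
  using assms by (subst vanishes_iff_funpow)
    (auto simp: funpow_partial_deriv_diff polynomial_funpow_partial_deriv)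

lemma funpow_partial_deriv_cong_open:
  assumes "open t" "\<And>x. x \<in> t \<Longrightarrow> p x = q x" "x \<in> t"
  shows "(partial_deriv i ^^ a) p x = (partial_deriv i ^^ a) q x"
  using assms(3)
proof (induction a arbitrary: x)
  case (Suc a)
  show ?case using partial_deriv_cong_open[OF assms(1) Suc.prems Suc.IH] by simp
qed (simp add: assms(2))

text \<open>\<open>spline_space\<close> speaks of any polynomials matching the pieces on open
  triangles; their derivatives agree there and, by continuity, on the edges as well.\<close>

lemma derivatives_eq_on_closure:
  assumes "open t" "real_polynomial_function p" "real_polynomial_function q"
    and "\<And>x. x \<in> t \<Longrightarrow> p x = q x" "x \<in> closure t"
  shows "(partial_deriv 1 ^^ a) ((partial_deriv 2 ^^ b) p) x = (partial_deriv 1 ^^ a) ((partial_deriv 2 ^^ b) q) x"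
  by (rule eq_on_closure[OF _ _ _ assms(5)], intro continuous_on_polynomial polynomial_funpow_partial_deriv assms,
      intro continuous_on_polynomial polynomial_funpow_partial_deriv assms,
      intro funpow_partial_deriv_cong_open[OF assms(1)] assms(4))

section \<open>Incidence of triangles and edges\<close>

lemma interior_edges:
  assumes "\<epsilon> \<in> edges i"
  shows "interior \<epsilon> = {}"
  using assms by (auto simp: edges_def interior_closed_segment)

lemma edgesE:
  assumes "\<epsilon> \<in> edges i"
  obtains w where "\<epsilon> = edge i w"
  using assms unfolding edges_def range_emb[symmetric] by blast

lemma triangle_not_edge:
  assumes "t \<in> triangles"
  shows "t \<notin> edges i" "closure t \<notin> edges i"
proof -
  have "interior t \<noteq> {}" using assms triangles_nonempty open_triangles interior_open by metis
  moreover have "interior t \<subseteq> interior (closure t)" by (intro interior_mono closure_subset)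
  ultimately show "t \<notin> edges i" "closure t \<notin> edges i" using interior_edges by blast+
qed

lemma triangles_Int_cell_hat:
  assumes "t \<in> triangles"
  shows "triangles \<inter> cell_hat t = {t}"
proof -
  have "{v} \<notin> triangles" for v :: point
    using open_triangles not_open_singleton by blast
  then show ?thesis
    using assms triangle_not_edge(1) unfolding cell_hat_def by blast
qed

text \<open>Overlapping open triangles would put a nonempty open set into the common edge. This
  makes \<open>glue\<close> equal to the second piece on all of \<open>t'\<close>.\<close>

lemma triangles_disjoint:
  assumes "t \<in> triangles" "t' \<in> triangles" "closure t \<inter> closure t' \<in> edges i"
  shows "t' \<inter> closure t = {}"
proof (rule ccontr)
  assume "t' \<inter> closure t \<noteq> {}"
  then have "t' \<inter> t \<noteq> {}"
    using open_Int_closure_eq_empty[OF open_triangles[OF assms(2)], of t] by simp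
  moreover have "t' \<inter> t \<subseteq> interior (closure t \<inter> closure t')"
    using closure_subset by (intro interior_maximal open_Int open_triangles assms) blast
  ultimately show False using interior_edges[OF assms(3)] by auto
qed

text \<open>The end points differ by a multiple of \<open>dir i\<close>, and no two of the three
  directions are parallel. This fixes the entry of \<open>d\<close> that governs the common
  edge.\<close>

lemma edge_direction_unique:
  assumes "\<epsilon> \<in> edges j" "\<epsilon> \<subseteq> edge i w"
  shows "j = i"
proof -
  obtain v where "\<epsilon> = edge j v" using edgesE[OF assms(1)] .
  have "emb v \<in> edge i w" "emb v + dir j \<in> edge i w"
    using assms(2) unfolding \<open>\<epsilon> = edge j v\<close> by auto
  then obtain r s where "emb v = (1 - r) *\<^sub>R emb w + r *\<^sub>R (emb w + dir i)"
    and "emb v + dir j = (1 - s) *\<^sub>R emb w + s *\<^sub>R (emb w + dir i)"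
    unfolding in_segment by blast
  then have "dir j = (s - r) *\<^sub>R dir i" by (simp add: algebra_simps)
  then show ?thesis using exhaust_3[of i] exhaust_3[of j] by auto
qed

theorem lemma22:
  fixes n d :: "nat ^ 3" and i :: 3
    and f f' :: "point \<Rightarrow> real" and t t' :: "point set" and M :: "point set set"
  assumes "\<forall>j. n $ j \<ge> 1"
    and "f \<in> poly_space n" and "f' \<in> poly_space n"
    and "t \<in> triangles" and "t' \<in> triangles"
    and "closure t \<inter> closure t' \<in> edges i"
    and "M = cell_hat t \<union> cell_hat t'"
    and "d = vector [n $ 2 + n $ 3 - 2, n $ 1 + n $ 3 - 2, n $ 1 + n $ 2 - 2]"
  shows "glue t f f' \<in> spline_space d M (poly_space n) \<longleftrightarrow>
    (\<forall>v \<in> active n t \<inter> active n t'. spline_coeff n t f v = spline_coeff n t' f' v)"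
proof -
  define m where "m = (\<lambda>j. n $ j - 1)"
  obtain w where w: "closure t \<inter> closure t' = edge i w" using edgesE[OF assms(6)] .
  have sub: "edge i w \<subseteq> closure t" "edge i w \<subseteq> closure t'" using w by blast+
  have op: "open t" "open t'" using open_triangles assms(4,5) by blast+
  have "t \<noteq> t'" using triangle_not_edge(2)[OF assms(4)] assms(6) by auto
  have pol: "real_polynomial_function p" if "p \<in> poly_space n" for p
    using that by (simp add: poly_space_def)
  have tM: "triangles \<inter> M = {t, t'}"
    using triangles_Int_cell_hat[OF assms(4)] triangles_Int_cell_hat[OF assms(5)]
    unfolding assms(7) Int_Un_distrib by auto
  have glue_t: "glue t f f' x = f x" if "x \<in> t" for x
    using that closure_subset by (auto simp: glue_def)
  have glue_t': "glue t f f' x = f' x" if "x \<in> t'" for x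
    using that triangles_disjoint[OF assms(4-6)] by (auto simp: glue_def)
  \<comment> \<open>Truncated subtraction is exact here since all components of \<open>n\<close> are
    at least 1.\<close>
  have d: "d $ i = order_across i m"
    using assms(1) exhaust_3[of i] by (auto simp: assms(8) order_across_def m_def)
  define C where "C = (\<lambda>v. spline_coeff n t f (emb v))"
  define C' where "C' = (\<lambda>v. spline_coeff n t' f' (emb v))"
  have f: "f x = spl m C x" if "x \<in> closure t" for x
    using spline_coeff_eq_spl[OF assms(2,4) that] by (simp only: m_def C_def)
  have f': "f' x = spl m C' x" if "x \<in> closure t'" for x
    using spline_coeff_eq_spl[OF assms(3,5) that] by (simp only: m_def C'_def)
  have coeffs: "(\<forall>v \<in> active n t \<inter> active n t'. spline_coeff n t f v = spline_coeff n t' f' v) \<longleftrightarrow>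
      (\<forall>v \<in> cell_active m t \<inter> cell_active m t'. C v = C' v)"
    unfolding active_eq_cell_active m_def[symmetric] image_Int[OF inj_emb, symmetric] C_def C'_def by blast
  \<comment> \<open>Two distinct triangles share only \<open>edge i w\<close>, so all smoothness
    conditions reduce to one order of vanishing there.\<close>
  have smooth: "glue t f f' \<in> spline_space d M (poly_space n) \<longleftrightarrow>
      vanishes (order_across i m) (\<lambda>x. f x - f' x) (edge i w)"
  proof
    assume *: "glue t f f' \<in> spline_space d M (poly_space n)"
    have E: "edge i w \<in> edges i" "edge i w \<in> cell_hat t" "edge i w \<in> cell_hat t'"
      using sub assms(6) unfolding w cell_hat_def by blast+
    note smooth = conjunct2[OF *[unfolded spline_space_def mem_Collect_eq], rule_format]
    show "vanishes (order_across i m) (\<lambda>x. f x - f' x) (edge i w)"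
      unfolding vanishes_diff_iff[OF pol[OF assms(2)] pol[OF assms(3)]]
    proof (intro allI impI ballI)
      fix a b x assume "a + b \<le> order_across i m" "x \<in> edge i w"
      with E tM assms(2,3) glue_t glue_t'
      show "(partial_deriv 1 ^^ a) ((partial_deriv 2 ^^ b) f) x = (partial_deriv 1 ^^ a) ((partial_deriv 2 ^^ b) f') x"
        by (intro smooth[of "edge i w" i t t']) (auto simp: d assms(7))
    qed
  next
    assume van: "vanishes (order_across i m) (\<lambda>x. f x - f' x) (edge i w)"
    have "continuous_on (closure t \<union> closure t') (\<lambda>x. if x \<in> closure t then f x else f' x)"
      using vanishes_zero[OF van] w
      by (intro continuous_on_cases continuous_on_polynomial pol assms) auto
    moreover have "body M = closure t \<union> closure t'" unfolding body_def tM by simp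
    ultimately have "glue t f f' \<in> pp_space M (poly_space n)"
      using assms(2,3) glue_t glue_t' unfolding pp_space_def tM glue_def[abs_def] by auto
    moreover have "(partial_deriv 1 ^^ a) ((partial_deriv 2 ^^ b) p) x = (partial_deriv 1 ^^ a) ((partial_deriv 2 ^^ b) q) x"
      if \<epsilon>: "\<epsilon> \<in> edges k \<inter> M" and T: "T \<in> triangles \<inter> M" "T' \<in> triangles \<inter> M" "\<epsilon> \<in> cell_hat T" "\<epsilon> \<in> cell_hat T'"
        and pq: "p \<in> poly_space n" "q \<in> poly_space n" "\<forall>x\<in>T. glue t f f' x = p x" "\<forall>x\<in>T'. glue t f f' x = q x"
        and ab: "a + b \<le> d $ k" and x: "x \<in> \<epsilon>" for k \<epsilon> T T' p q a b x
    proof -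
      let ?D = "\<lambda>p. (partial_deriv 1 ^^ a) ((partial_deriv 2 ^^ b) p) x"
      have sub_cl: "\<epsilon> \<subseteq> closure T" "\<epsilon> \<subseteq> closure T'"
        using T(3,4) closure_subset by (auto simp: cell_hat_def)
      have D: "?D p = ?D q" if "T = T'"
        using that sub_cl x pq T
        by (intro derivatives_eq_on_closure[of T]) (auto intro: pol open_triangles)
      have across: "?D f = ?D f'" if "T \<noteq> T'"
      proof -
        have sub_E: "\<epsilon> \<subseteq> edge i w" using that T(1,2) sub_cl unfolding tM w[symmetric] by blast
        have "k = i" using \<epsilon> sub_E by (intro edge_direction_unique) auto
        then have "a + b \<le> order_across i m" "x \<in> edge i w" using ab x sub_E d by auto
        then show ?thesis
          using van[unfolded vanishes_diff_iff[OF pol[OF assms(2)] pol[OF assms(3)]]] by blast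
      qed
      have piece: "?D r = ?D (if S = t then f else f')"
        if "S \<in> {t, t'}" "x \<in> closure S" "r \<in> poly_space n" "\<forall>x\<in>S. glue t f f' x = r x" for S r
        using that op glue_t glue_t' assms(2,3) \<open>t \<noteq> t'\<close>
        by (intro derivatives_eq_on_closure[of S]) (auto intro: pol)
      have TT': "T \<in> {t, t'}" "T' \<in> {t, t'}" using T(1,2) unfolding tM by blast+
      have "?D p = ?D (if T = t then f else f')" "?D q = ?D (if T' = t then f else f')"
        using TT' sub_cl x pq by (blast intro!: piece)+
      then show ?thesis using D across TT' \<open>t \<noteq> t'\<close> by (elim insertE) simp_all
    qed
    ultimately show "glue t f f' \<in> spline_space d M (poly_space n)" unfolding spline_space_def by blast
  qed
  show ?thesis
    unfolding smooth coeffs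
  proof
    assume van: "vanishes (order_across i m) (\<lambda>x. f x - f' x) (edge i w)"
    have "formally_zero (edge i w) m (\<lambda>v. C v - C' v)"
      using f f' closure_subset
      by (intro vanishes_imp_formally_zero[OF op sub pol[OF assms(2)] pol[OF assms(3)] _ _ van]) blast+
    then have "C v - C' v = 0" if "v \<in> edge_active i w m" for v
      by (rule formally_zero_imp_zero[OF _ that])
    then show "\<forall>v \<in> cell_active m t \<inter> cell_active m t'. C v = C' v"
      using cell_active_Int_subset[OF assms(4,5) \<open>t \<noteq> t'\<close> sub] by fastforce
  next
    assume eq: "\<forall>v \<in> cell_active m t \<inter> cell_active m t'. C v = C' v"
    \<comment> \<open>One family serves both triangles: on \<open>t\<close> only indices active
      there are read, giving \<open>C\<close>; on \<open>t'\<close> the indices where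
      \<open>C\<close> was chosen are common to both triangles, so \<open>C\<close> and
      \<open>C'\<close> agree.\<close>
    define c where "c v = (if v \<in> cell_active m t then C v else C' v)" for v
    have "f x = spl m c x" if "x \<in> t" for x
    proof -
      have x: "x \<in> closure t" using that closure_subset by blast
      have "spl m C x = spl m c x"
        unfolding spl_def using x by (intro sum.cong) (auto simp: c_def cell_active_def)
      then show ?thesis using f[OF x] by simp
    qed
    moreover have "f' x = spl m c x" if "x \<in> t'" for x
    proof -
      have x: "x \<in> closure t'" using that closure_subset by blast
      have "c v = C' v" if "x - emb v \<in> hexagon m" for v
      proof -
        have "v \<in> cell_active m t'" using that x by (auto simp: cell_active_def)
        then show ?thesis using eq by (simp add: c_def)
      qed
      then have "spl m C' x = spl m c x" unfolding spl_def by (intro sum.cong) auto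
      then show ?thesis using f'[OF x] by simp
    qed
    ultimately show "vanishes (order_across i m) (\<lambda>x. f x - f' x) (edge i w)"
      by (intro equal_coefficients_imp_vanishes[OF op sub pol[OF assms(2)] pol[OF assms(3)]])
  qed
qed

end
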